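(* Let $m\ge 9$. Among all connected graphs with exactly $m$ edges, the eleven graphs $K_{1,m},G_{0,3},T_1,B_1,B_2,G_{1,3},G_{v,3},T_2,G_{0,4},T_3,T_4$ are the ones with the eleven largest $Q$-indices, and $$q(K_{1,m})>q(G_{0,3})>q(T_1)>q(B_1)>q(B_2)>q(G_{1,3})>q(G_{v,3})>q(T_2)>q(G_{0,4})>q(T_3)>q(T_4);$$ that is, these inequalities hold and every connected graph with $m$ edges not isomorphic to one of these eleven graphs has $Q$-index smaller than $q(T_4)$.
   Context: All graphs are finite, simple and undirected. For a graph $G$, $Q(G)=D(G)+A(G)$ is its signless Laplacian matrix, and the $Q$-index $q(G)$ is the largest eigenvalue of $Q(G)$. $K_{1,m}$ is the star with $m$ edges. Let $C_3=0120$ be a triangle and $C_4=01230$ a 4-cycle. $G_{0,3}$: attach $m-3$ pendant edges at vertex $0$ of $C_3$. $G_{1,3}$: attach $m-4$ pendant edges at vertex $0$ and one pendant edge at vertex $1$ of $C_3$. $G_{v,3}$: attach $m-5$ pendant edges at vertex $0$ of $C_3$ and a path $0vv_1$ with two new vertices. $G_{0,4}$: attach $m-4$ pendant edges at vertex $0$ of $C_4$. $B_1$: take two triangles sharing a common edge ($K_4$ minus an edge) and attach $m-5$ pendant edges at one end-vertex of the common edge. $B_2$: take two triangles sharing a common vertex and attach $m-6$ pendant edges at that vertex. The trees, each with $m$ edges: $T_1$ is obtained from a star whose center has $m-1$ neighbours by attaching one pendant edge to one of its leaves (so $\Delta(T_1)=m-1$); $T_2$ has a center adjacent to $m-3$ leaves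 and to one further vertex that has two pendant leaves; $T_3$ has a center adjacent to $m-4$ leaves and to two further vertices, each of which has one pendant leaf (two pendant paths of length 2 at the center); $T_4$ has a center adjacent to $m-3$ leaves and to the first vertex of a pendant path of length $3$ starting at the center. Thus $\Delta(T_2)=\Delta(T_3)=\Delta(T_4)=m-2$. *)

theory Defs
  imports
    "Graph_Theory.Digraph_Component"
    "Graph_Theory.Digraph_Isomorphism"
    "Jordan_Normal_Form.Spectral_Radius"
begin

text \<open>
  A finite simple undirected graph is a \<open>pair_graph\<close>: a finite, loop-free, symmetric relation
  \<^const>\<open>parcs\<close> on a finite vertex set \<^const>\<open>pverts\<close>. Each undirected edge is a pair of
  opposite arcs, so edges are counted as two-element sets.
\<close>

definition uedges :: "'a pair_pre_digraph \<Rightarrow> 'a set set" where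
  "uedges G = (\<lambda>(u, v). {u, v}) ` parcs G"

definition connected_with_edges :: "nat \<Rightarrow> 'a pair_pre_digraph \<Rightarrow> bool" where
  "connected_with_edges m G \<longleftrightarrow>
     pair_graph G \<and> connected (with_proj G) \<and> card (uedges G) = m"

text \<open>
  Matrices are indexed by natural numbers, hence the enumeration \<open>vs\<close> of the vertices.
  Another enumeration conjugates the matrices by a permutation matrix, so the eigenvalues do not
  depend on the choice made in \<open>vertex_list\<close>.
\<close>

definition vertex_list :: "'a pair_pre_digraph \<Rightarrow> 'a list" where
  "vertex_list G = (SOME vs. distinct vs \<and> set vs = pverts G)"

definition degree_mat :: "'a pair_pre_digraph \<Rightarrow> real mat" where
  "degree_mat G = (let vs = vertex_list G; n = length vs in
     mat n n (\<lambda>(i, j). if i = j then real (out_degree (with_proj G) (vs ! i)) else 0))"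

definition adjacency_mat :: "'a pair_pre_digraph \<Rightarrow> real mat" where
  "adjacency_mat G = (let vs = vertex_list G; n = length vs in
     mat n n (\<lambda>(i, j). if (vs ! i, vs ! j) \<in> parcs G then 1 else 0))"

definition signless_laplacian :: "'a pair_pre_digraph \<Rightarrow> real mat" where
  "signless_laplacian G = degree_mat G + adjacency_mat G"

text \<open>The matrix is real symmetric, so its real spectrum is its whole spectrum.\<close>

definition q_index :: "'a pair_pre_digraph \<Rightarrow> real" where
  "q_index G = Max (spectrum (signless_laplacian G))"

text \<open>
  In the graphs below, vertex \<open>0\<close> is the vertex of largest degree and the set
  \<open>{0} \<times> _\<close> gives the pendant edges at \<open>0\<close>.
\<close>

definition ugraph :: "nat \<Rightarrow> nat rel \<Rightarrow> nat pair_pre_digraph" where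
  "ugraph n E = \<lparr> pverts = {..<n}, parcs = E \<union> E\<inverse> \<rparr>"

definition graph_K1 :: "nat \<Rightarrow> nat pair_pre_digraph" where
  "graph_K1 m = ugraph (m + 1) ({0} \<times> {1..m})"

definition graph_G03 :: "nat \<Rightarrow> nat pair_pre_digraph" where
  "graph_G03 m = ugraph m ({(0,1), (1,2), (2,0)} \<union> {0} \<times> {3..<m})"

definition graph_G13 :: "nat \<Rightarrow> nat pair_pre_digraph" where
  "graph_G13 m = ugraph m ({(0,1), (1,2), (2,0), (1,3)} \<union> {0} \<times> {4..<m})"

definition graph_Gv3 :: "nat \<Rightarrow> nat pair_pre_digraph" where
  "graph_Gv3 m = ugraph m ({(0,1), (1,2), (2,0), (0,3), (3,4)} \<union> {0} \<times> {5..<m})"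

definition graph_G04 :: "nat \<Rightarrow> nat pair_pre_digraph" where
  "graph_G04 m = ugraph m ({(0,1), (1,2), (2,3), (3,0)} \<union> {0} \<times> {4..<m})"

definition graph_B1 :: "nat \<Rightarrow> nat pair_pre_digraph" where
  "graph_B1 m =
     ugraph (m - 1) ({(0,1), (1,2), (2,0), (1,3), (3,0)} \<union> {0} \<times> {4..<m - 1})"

definition graph_B2 :: "nat \<Rightarrow> nat pair_pre_digraph" where
  "graph_B2 m =
     ugraph (m - 1)
       ({(0,1), (1,2), (2,0), (0,3), (3,4), (4,0)} \<union> {0} \<times> {5..<m - 1})"

definition graph_T1 :: "nat \<Rightarrow> nat pair_pre_digraph" where
  "graph_T1 m = ugraph (m + 1) ({(0,1), (1,2)} \<union> {0} \<times> {3..m})"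

definition graph_T2 :: "nat \<Rightarrow> nat pair_pre_digraph" where
  "graph_T2 m = ugraph (m + 1) ({(0,1), (1,2), (1,3)} \<union> {0} \<times> {4..m})"

definition graph_T3 :: "nat \<Rightarrow> nat pair_pre_digraph" where
  "graph_T3 m = ugraph (m + 1) ({(0,1), (1,2), (0,3), (3,4)} \<union> {0} \<times> {5..m})"

definition graph_T4 :: "nat \<Rightarrow> nat pair_pre_digraph" where
  "graph_T4 m = ugraph (m + 1) ({(0,1), (1,2), (2,3)} \<union> {0} \<times> {4..m})"

end

theory Submission
  imports Defs
begin

text \<open>
  Let \<open>Q\<close> be the signless Laplacian, so that \<open>(Q x) v\<close> is the sum of \<open>x v + x u\<close> over the neighbours
  \<open>u\<close> of \<open>v\<close>. A positive \<open>y\<close> with \<open>Q y \<le> c y\<close> bounds every eigenvalue by \<open>c\<close>, and a positive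
  eigenvector belongs to the largest eigenvalue.

  If all degrees are at most \<open>m - 3\<close>, the degree vector shows that the \<open>Q\<close>-index is at most
  \<open>m - 1\<close>: for a vertex of degree \<open>d \<ge> 3\<close> this amounts to \<open>d\<^sup>2 + 2 m \<le> m d\<close>, which holds for
  \<open>3 \<le> d \<le> m - 3\<close> precisely because \<open>m \<ge> 9\<close>. Otherwise at most two edges avoid a vertex of maximum
  degree, and connectedness leaves only the eleven graphs of the theorem.

  For each of these graphs the \<open>Q\<close>-index is the root of a scalar equation with an explicit positive
  eigenvector. Comparing the right-hand sides of the equations and applying the intermediate value
  theorem puts the roots in order, all of them above \<open>m - 1\<close>.
\<close>

section \<open>Eigenvalues and positive test vectors\<close>

text \<open>The maximum in \<open>q_index\<close> ranges over real eigenvalues, so one has to exist.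
  Over the complex numbers there is an eigenpair \<open>c\<close>, \<open>z\<close>. Writing
  \<open>z\<close> as \<open>a + i b\<close> and splitting the equation into real and imaginary
  parts, symmetry forces \<open>c\<close> to be real, and then whichever of \<open>a\<close>,
  \<open>b\<close> is nonzero is a real eigenvector.\<close>

lemma real_symmetric_has_eigenvalue:
  fixes A :: "real mat"
  assumes A: "A \<in> carrier_mat n n" and sym: "transpose_mat A = A" and n: "n > 0"
  shows "\<exists>k. eigenvalue A k"
proof -
  let ?B = "map_mat complex_of_real A"
  have B: "?B \<in> carrier_mat n n" using A by simp
  obtain c z where z: "z \<in> carrier_vec n" "z \<noteq> 0\<^sub>v n" "?B *\<^sub>v z = c \<cdot>\<^sub>v z"
    using spectrum_non_empty[OF B n] A by (auto simp: spectrum_def eigenvalue_def eigenvector_def)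
  define a b where "a = map_vec Re z" and "b = map_vec Im z"
  have ab: "a \<in> carrier_vec n" "b \<in> carrier_vec n" using z by (auto simp: a_def b_def)
  have eq: "(\<Sum>j<n. complex_of_real (A $$ (i,j)) * z $ j) = c * z $ i" if "i < n" for i
  proof -
    have "(?B *\<^sub>v z) $ i = (c \<cdot>\<^sub>v z) $ i" using z by simp
    then show ?thesis using that z(1) A by (simp add: scalar_prod_def atLeast0LessThan)
  qed
  have Aa: "A *\<^sub>v a = Re c \<cdot>\<^sub>v a - Im c \<cdot>\<^sub>v b"
  proof (rule eq_vecI)
    fix i assume "i < dim_vec (Re c \<cdot>\<^sub>v a - Im c \<cdot>\<^sub>v b)"
    then have i: "i < n" using ab by simp
    from arg_cong[OF eq[OF i], of Re] show "(A *\<^sub>v a) $ i = (Re c \<cdot>\<^sub>v a - Im c \<cdot>\<^sub>v b) $ i"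
      using i z A by (simp add: a_def b_def scalar_prod_def atLeast0LessThan)
  qed (use A ab in auto)
  have Ab: "A *\<^sub>v b = Im c \<cdot>\<^sub>v a + Re c \<cdot>\<^sub>v b"
  proof (rule eq_vecI)
    fix i assume "i < dim_vec (Im c \<cdot>\<^sub>v a + Re c \<cdot>\<^sub>v b)"
    then have i: "i < n" using ab by simp
    from arg_cong[OF eq[OF i], of Im] show "(A *\<^sub>v b) $ i = (Im c \<cdot>\<^sub>v a + Re c \<cdot>\<^sub>v b) $ i"
      using i z A by (simp add: a_def b_def scalar_prod_def atLeast0LessThan add.commute)
  qed (use A ab in auto)
  have sq: "0 \<le> v \<bullet> v" "v \<bullet> v = 0 \<longleftrightarrow> v = 0\<^sub>v n" if "v \<in> carrier_vec n" for v :: "real vec"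
    using that by (auto simp: scalar_prod_def sum_nonneg sum_nonneg_eq_0_iff intro!: eq_vecI)
  have nz: "a \<noteq> 0\<^sub>v n \<or> b \<noteq> 0\<^sub>v n"
  proof (rule ccontr)
    assume *: "\<not> ?thesis"
    have "z = 0\<^sub>v n"
    proof (rule eq_vecI)
      fix i assume i: "i < dim_vec (0\<^sub>v n :: complex vec)"
      have "a $ i = 0" "b $ i = 0" using * i by auto
      then show "z $ i = 0\<^sub>v n $ i" using i z by (simp add: a_def b_def complex_eq_iff)
    qed (use z in auto)
    with z show False by simp
  qed
  \<comment> \<open>Inserting \<open>Aa\<close> and \<open>Ab\<close> makes the \<open>Re c\<close>
    terms cancel; what is left is \<open>Im c\<close> times the squared norm of \<open>z\<close>,
    which is positive.\<close>
  have "b \<bullet> (A *\<^sub>v a) = a \<bullet> (A *\<^sub>v b)"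
    using transpose_vec_mult_scalar[OF A ab(1,2)] comm_scalar_prod[of "A *\<^sub>v b" n a] A ab sym
    by simp
  then have "Im c * (a \<bullet> a + b \<bullet> b) = 0"
    using ab unfolding Aa Ab
    by (simp add: scalar_prod_add_distrib[of _ n] scalar_prod_minus_distrib[of _ n]
        comm_scalar_prod[of b n a] algebra_simps)
  then have "Im c = 0" using sq[OF ab(1)] sq[OF ab(2)] nz by (smt (verit) mult_eq_0_iff)
  then have "A *\<^sub>v a = Re c \<cdot>\<^sub>v a" "A *\<^sub>v b = Re c \<cdot>\<^sub>v b"
    unfolding Aa Ab using ab by auto
  then show ?thesis using nz ab A by (auto simp: eigenvalue_def eigenvector_def)
qed

section \<open>The signless Laplacian as an operator on functions of the vertices\<close>

lemma vertex_list:
  assumes "finite (pverts G)"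
  shows "distinct (vertex_list G)" "set (vertex_list G) = pverts G"
proof -
  have "\<exists>vs. distinct vs \<and> set vs = pverts G" using finite_distinct_list[OF assms] by blast
  from someI_ex[OF this] show "distinct (vertex_list G)" "set (vertex_list G) = pverts G"
    unfolding vertex_list_def by auto
qed

lemma signless_laplacian_carrier:
  "signless_laplacian G \<in> carrier_mat (length (vertex_list G)) (length (vertex_list G))"
  by (simp add: signless_laplacian_def degree_mat_def adjacency_mat_def Let_def)

lemma out_degree_with_proj: "out_degree (with_proj G) v = card (parcs G `` {v})"
proof -
  have "out_arcs (with_proj G) v = Pair v ` (parcs G `` {v})" by (auto simp: out_arcs_def)
  then show ?thesis by (simp add: out_degree_def card_image inj_on_def)
qed

context pair_graph
begin

abbreviation nbrs :: "'a \<Rightarrow> 'a set" where "nbrs v \<equiv> parcs G `` {v}"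

lemma nbrs_subset: "nbrs v \<subseteq> pverts G"
  using in_arcsD2 by auto

lemma finite_nbrs: "finite (nbrs v)"
  using nbrs_subset pair_finite_verts finite_subset by blast

lemma nbrs_sym: "u \<in> nbrs v \<longleftrightarrow> v \<in> nbrs u"
  using arcs_symmetric by auto

lemma nbrs_irrefl: "v \<notin> nbrs v"
  using no_loops' by auto

lemma signless_laplacian_mult_vec:
  assumes i: "i < length (vertex_list G)"
  shows "(signless_laplacian G *\<^sub>v vec (length (vertex_list G)) (\<lambda>i. x (vertex_list G ! i))) $ i
    = (\<Sum>u\<in>nbrs (vertex_list G ! i). x (vertex_list G ! i) + x u)" (is "?L = _")
proof -
  let ?vs = "vertex_list G" and ?n = "length (vertex_list G)"
  let ?v = "?vs ! i"
  note vs = vertex_list[OF pair_finite_verts]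
  have bij: "bij_betw (nth ?vs) {..<?n} (pverts G)" by (rule bij_betw_nth[OF vs(1) refl vs(2)[symmetric]])
  have "?L = (\<Sum>j<?n. ((if i = j then card (nbrs ?v) else 0) + (if ?vs ! j \<in> nbrs ?v then 1 else 0))
      * x (?vs ! j))"
    using i by (auto simp: signless_laplacian_def degree_mat_def adjacency_mat_def Let_def
        scalar_prod_def atLeast0LessThan out_degree_with_proj intro!: sum.cong)
  also have "\<dots> = (\<Sum>j<?n. (if i = j then card (nbrs ?v) * x (?vs ! j) else 0)
      + (if ?vs ! j \<in> nbrs ?v then x (?vs ! j) else 0))"
    by (intro sum.cong) (auto simp: distrib_right)
  also have "\<dots> = card (nbrs ?v) * x ?v + (\<Sum>j<?n. (if ?vs ! j \<in> nbrs ?v then x (?vs ! j) else 0))"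
    using i by (simp add: sum.distrib)
  also have "(\<Sum>j<?n. (if ?vs ! j \<in> nbrs ?v then x (?vs ! j) else 0))
      = (\<Sum>u\<in>pverts G. if u \<in> nbrs ?v then x u else 0)"
    by (rule sum.reindex_bij_betw[OF bij])
  also have "\<dots> = (\<Sum>u\<in>nbrs ?v. x u)"
    using nbrs_subset pair_finite_verts by (intro sum.mono_neutral_cong_right) auto
  finally show ?thesis by (simp add: sum.distrib)
qed

text \<open>This removes the enumeration \<open>vertex_list\<close> from all later arguments:
  eigenvectors become functions on vertices, and every bound can be checked locally at a vertex and
  its neighbours.\<close>

lemma eigenvalue_signless_laplacian_iff:
  "eigenvalue (signless_laplacian G) k \<longleftrightarrow>
    (\<exists>x. (\<exists>v\<in>pverts G. x v \<noteq> 0) \<and> (\<forall>v\<in>pverts G. (\<Sum>u\<in>nbrs v. x v + x u) = k * x v))"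
  (is "_ \<longleftrightarrow> ?R")
proof
  let ?vs = "vertex_list G" and ?n = "length (vertex_list G)"
  note vs = vertex_list[OF pair_finite_verts]
  have L: "dim_row (signless_laplacian G) = ?n" using signless_laplacian_carrier by blast
  {
    assume "eigenvalue (signless_laplacian G) k"
    then obtain w where w: "w \<in> carrier_vec ?n" "w \<noteq> 0\<^sub>v ?n" "signless_laplacian G *\<^sub>v w = k \<cdot>\<^sub>v w"
      by (auto simp: eigenvalue_def eigenvector_def L)
    \<comment> \<open>The vector is read back along the inverse of the enumeration. Values off
      \<open>pverts G\<close> are arbitrary and never enter, since neighbours are vertices.\<close>
    define x where "x v = w $ (the_inv_into {..<?n} (nth ?vs) v)" for v
    have inj: "inj_on (nth ?vs) {..<?n}" using vs by (simp add: inj_on_nth)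
    have x: "x (?vs ! i) = w $ i" if "i < ?n" for i
      using the_inv_into_f_f[OF inj] that by (simp add: x_def)
    have wx: "w = vec ?n (\<lambda>i. x (?vs ! i))" using w x by (intro eq_vecI) auto
    have ex: "\<exists>i<?n. v = ?vs ! i" if "v \<in> pverts G" for v
      using that vs by (metis in_set_conv_nth)
    have "\<exists>i<?n. w $ i \<noteq> 0"
    proof (rule ccontr)
      assume "\<not> ?thesis"
      then have "w = 0\<^sub>v ?n" using w by (intro eq_vecI) auto
      with w show False by simp
    qed
    then have "\<exists>v\<in>pverts G. x v \<noteq> 0" using x vs nth_mem by metis
    moreover have "(\<Sum>u\<in>nbrs v. x v + x u) = k * x v" if "v \<in> pverts G" for v
    proof -
      obtain i where i: "i < ?n" "v = ?vs ! i" using ex[OF \<open>v \<in> pverts G\<close>] by blast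
      have "(signless_laplacian G *\<^sub>v w) $ i = (k \<cdot>\<^sub>v w) $ i" using w by simp
      then show ?thesis using signless_laplacian_mult_vec[OF i(1), of x] i w(1) x by (simp flip: wx)
    qed
    ultimately show ?R by blast
  }
  assume ?R
  then obtain x v where v: "v \<in> pverts G" "x v \<noteq> 0"
    and x: "\<forall>v\<in>pverts G. (\<Sum>u\<in>nbrs v. x v + x u) = k * x v" by blast
  define w where "w = vec ?n (\<lambda>i. x (?vs ! i))"
  obtain i where i: "i < ?n" "v = ?vs ! i" using v vs by (metis in_set_conv_nth)
  have "w $ i \<noteq> 0" using i v by (simp add: w_def)
  then have "w \<noteq> 0\<^sub>v ?n" using i by auto
  moreover have "signless_laplacian G *\<^sub>v w = k \<cdot>\<^sub>v w"
  proof (rule eq_vecI)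
    fix j assume "j < dim_vec (k \<cdot>\<^sub>v w)"
    then have j: "j < ?n" by (simp add: w_def)
    then have "?vs ! j \<in> pverts G" using vs nth_mem by blast
    then show "(signless_laplacian G *\<^sub>v w) $ j = (k \<cdot>\<^sub>v w) $ j"
      using signless_laplacian_mult_vec[OF j, of x] x j by (simp add: w_def)
  qed (simp add: L w_def)
  ultimately show "eigenvalue (signless_laplacian G) k"
    unfolding eigenvalue_def eigenvector_def L by (intro exI[of _ w]) (simp add: w_def)
qed

section \<open>Bounds for the largest eigenvalue from positive vectors\<close>

lemma eigenvalue_le:
  assumes "eigenvalue (signless_laplacian G) k"
    and pos: "\<And>v. v \<in> pverts G \<Longrightarrow> y v > 0"
    and le: "\<And>v. v \<in> pverts G \<Longrightarrow> (\<Sum>u\<in>nbrs v. y v + y u) \<le> c * y v"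
  shows "k \<le> c"
proof -
  obtain x w where w: "w \<in> pverts G" "x w \<noteq> 0"
    and x: "\<And>v. v \<in> pverts G \<Longrightarrow> (\<Sum>u\<in>nbrs v. x v + x u) = k * x v"
    using assms(1) unfolding eigenvalue_signless_laplacian_iff by blast
  \<comment> \<open>Collatz-Wielandt argument: at a vertex \<open>v\<close> where
    \<open>\<bar>x v\<bar> / y v\<close> takes its maximum \<open>r\<close>, the eigenvalue equation
    is compared with the inequality for \<open>y\<close>. This works because \<open>Q\<close> has
    nonnegative entries, so \<open>\<bar>x u\<bar> \<le> r * y u\<close> can be summed over the
    neighbours.\<close>
  let ?r = "\<lambda>v. \<bar>x v\<bar> / y v"
  have "Max (?r ` pverts G) \<in> ?r ` pverts G" using w pair_finite_verts by (intro Max_in) auto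
  then obtain v where v: "v \<in> pverts G" "Max (?r ` pverts G) = ?r v" by blast
  have max: "?r u \<le> ?r v" if "u \<in> pverts G" for u
    unfolding v(2)[symmetric] using that pair_finite_verts by (intro Max_ge) auto
  define r where "r = ?r v"
  have xv: "\<bar>x v\<bar> = r * y v" using pos[OF v(1)] by (simp add: r_def)
  have xu: "\<bar>x u\<bar> \<le> r * y u" if "u \<in> pverts G" for u
    using max[OF that] pos[OF that] by (simp add: r_def field_simps)
  have "0 < ?r w" using w pos by simp
  then have "r > 0" using max[OF w(1)] by (simp add: r_def)
  \<comment> \<open>The sign of \<open>k\<close> is not known here, hence an inequality instead of
    an equality.\<close>
  have "k * \<bar>x v\<bar> \<le> \<bar>k * x v\<bar>" by (simp add: abs_mult mult_right_mono)
  also have "\<dots> = \<bar>\<Sum>u\<in>nbrs v. x v + x u\<bar>" by (simp add: x[OF v(1)])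
  also have "\<dots> \<le> (\<Sum>u\<in>nbrs v. r * y v + r * y u)"
  proof (rule order_trans[OF sum_abs sum_mono])
    fix u assume "u \<in> nbrs v"
    then have "u \<in> pverts G" using nbrs_subset by blast
    from xu[OF this] xv show "\<bar>x v + x u\<bar> \<le> r * y v + r * y u" by linarith
  qed
  also have "\<dots> = r * (\<Sum>u\<in>nbrs v. y v + y u)" by (simp add: sum_distrib_left distrib_left)
  also have "\<dots> \<le> r * (c * y v)" using le[OF v(1)] \<open>r > 0\<close> by simp
  finally have "(r * y v) * k \<le> (r * y v) * c" unfolding xv by (simp add: algebra_simps)
  then show ?thesis using \<open>r > 0\<close> pos[OF v(1)] by simp
qed

lemma finite_spectrum_signless_laplacian: "finite (spectrum (signless_laplacian G))"
  using card_finite_spectrum signless_laplacian_carrier by blast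

text \<open>A positive eigenvector serves twice: as a test vector it bounds every eigenvalue by
  \<open>c\<close>, and as an eigenvector it shows that \<open>c\<close> is attained.\<close>

lemma q_index_eqI:
  assumes "pverts G \<noteq> {}"
    and pos: "\<And>v. v \<in> pverts G \<Longrightarrow> y v > 0"
    and eq: "\<And>v. v \<in> pverts G \<Longrightarrow> (\<Sum>u\<in>nbrs v. y v + y u) = c * y v"
  shows "q_index G = c"
  unfolding q_index_def
proof (rule Max_eqI)
  show "finite (spectrum (signless_laplacian G))" by (rule finite_spectrum_signless_laplacian)
  show "k \<le> c" if "k \<in> spectrum (signless_laplacian G)" for k
    using that eigenvalue_le[of k y c] pos eq by (simp add: spectrum_def)
  obtain v where "v \<in> pverts G" using assms(1) by blast
  then have "y v \<noteq> 0" using pos by force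
  with \<open>v \<in> pverts G\<close> eq show "c \<in> spectrum (signless_laplacian G)"
    unfolding spectrum_def mem_Collect_eq eigenvalue_signless_laplacian_iff by blast
qed

text \<open>Unlike in \<open>q_index_eqI\<close>, no eigenvalue is given in advance. Without one the
  \<open>Max\<close> would be unspecified, so non-emptiness of the spectrum comes from the symmetry
  of the matrix.\<close>

lemma q_index_le:
  assumes ne: "pverts G \<noteq> {}"
    and pos: "\<And>v. v \<in> pverts G \<Longrightarrow> y v > 0"
    and le: "\<And>v. v \<in> pverts G \<Longrightarrow> (\<Sum>u\<in>nbrs v. y v + y u) \<le> c * y v"
  shows "q_index G \<le> c"
proof -
  let ?n = "length (vertex_list G)"
  have "?n > 0" using ne vertex_list(2)[OF pair_finite_verts] by auto
  moreover have "transpose_mat (signless_laplacian G) = signless_laplacian G"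
    using arcs_symmetric
    by (auto simp: signless_laplacian_def degree_mat_def adjacency_mat_def Let_def intro!: eq_matI)
  ultimately have "\<exists>k. eigenvalue (signless_laplacian G) k"
    using real_symmetric_has_eigenvalue signless_laplacian_carrier by blast
  then have "spectrum (signless_laplacian G) \<noteq> {}" by (auto simp: spectrum_def)
  then show ?thesis
    unfolding q_index_def using finite_spectrum_signless_laplacian eigenvalue_le[OF _ pos le]
    by (simp add: spectrum_def)
qed

end

section \<open>Stars with a finite core\<close>

lemma pair_graph_ugraph:
  assumes "E \<subseteq> {..<n} \<times> {..<n}" "\<And>v. (v, v) \<notin> E"
  shows "pair_graph (ugraph n E)"
proof
  have "finite E" using assms(1) finite_subset by blast
  then show "finite (parcs (ugraph n E))" by (simp add: ugraph_def)
  show "symmetric (with_proj (ugraph n E))" by (auto simp: symmetric_def ugraph_def sym_def)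
qed (use assms in \<open>auto simp: ugraph_def\<close>)

text \<open>Repeatedly passing to a smaller neighbour ends at \<open>0\<close>, so every vertex is
  reachable from \<open>0\<close>; symmetry of the arcs then joins any two vertices.\<close>

lemma connected_ugraph:
  assumes "pair_graph (ugraph n E)" "n > 0"
    and parent: "\<And>v. 0 < v \<Longrightarrow> v < n \<Longrightarrow> \<exists>u<v. (u, v) \<in> E \<union> E\<inverse>"
  shows "connected (with_proj (ugraph n E))"
proof -
  interpret pair_graph "ugraph n E" by fact
  let ?G = "with_proj (ugraph n E)"
  have "0 \<rightarrow>\<^sup>*\<^bsub>?G\<^esub> v" if "v < n" for v
    using that
  proof (induction v rule: less_induct)
    case (less v)
    show ?case
    proof (cases "v = 0")
      case True
      then have "v \<in> pverts (ugraph n E)" using \<open>n > 0\<close> by (simp add: ugraph_def)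
      then show ?thesis using True by simp
    next
      case False
      then obtain u where u: "u < v" "(u, v) \<in> parcs (ugraph n E)"
        using parent[of v] less.prems by (auto simp: ugraph_def)
      then have "0 \<rightarrow>\<^sup>*\<^bsub>?G\<^esub> u" using less by simp
      with u(2) show ?thesis by (simp add: reachable_adj_trans)
    qed
  qed
  then have "u \<rightarrow>\<^sup>*\<^bsub>?G\<^esub> v" if "u < n" "v < n" for u v
    using that by (meson reachable_trans symmetric_reachable')
  then have "\<forall>u\<in>verts ?G. \<forall>v\<in>verts ?G. u \<rightarrow>\<^sup>*\<^bsub>?G\<^esub> v" by (simp add: ugraph_def)
  moreover have "verts ?G \<noteq> {}" using \<open>n > 0\<close> by (auto simp: ugraph_def)
  moreover have "(arcs_ends ?G)\<^sup>s = arcs_ends ?G" by (auto simp: symcl_def ugraph_def)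
  ultimately show ?thesis by (simp add: connected_conv reachable_def)
qed

lemma card_uedges_ugraph:
  assumes asym: "\<And>u v. (u, v) \<in> E \<Longrightarrow> (v, u) \<notin> E"
  shows "card (uedges (ugraph n E)) = card E"
proof -
  have "uedges (ugraph n E) = (\<lambda>(u, v). {u, v}) ` E"
    by (force simp: uedges_def ugraph_def insert_commute)
  moreover have "inj_on (\<lambda>(u, v). {u, v}) E"
    using asym by (auto simp: inj_on_def doubleton_eq_iff)
  ultimately show ?thesis by (simp add: card_image)
qed

text \<open>Neighbours in the symmetric closure, in a form that simplification evaluates on concrete
  lists; all conditions on a core are checked that way.\<close>

definition adj_list :: "('a \<times> 'a) list \<Rightarrow> 'a \<Rightarrow> 'a list" where
  "adj_list L v = map snd (filter (\<lambda>p. fst p = v) L) @ map fst (filter (\<lambda>p. snd p = v) L)"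

lemma set_adj_list: "set (adj_list L v) = (set L \<union> (set L)\<inverse>) `` {v}"
  by (force simp: adj_list_def)

text \<open>A core with edge list \<open>L\<close> on the vertices below \<open>k\<close>, with the
  vertices from \<open>k\<close> up to \<open>n - 1\<close> pendant at \<open>0\<close>. All eleven
  graphs have this shape, with a core that does not depend on \<open>m\<close>.\<close>

definition star_ext :: "(nat \<times> nat) list \<Rightarrow> nat \<Rightarrow> nat \<Rightarrow> nat pair_pre_digraph" where
  "star_ext L k n = ugraph n (set L \<union> {0} \<times> {k..<n})"

text \<open>
  The condition \<open>(v, u) \<notin> set L\<close> makes sure that no edge is listed twice. The
  smaller neighbour of each vertex provides a path to \<open>0\<close>.
\<close>

definition core_list :: "(nat \<times> nat) list \<Rightarrow> nat \<Rightarrow> bool" where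
  "core_list L k \<longleftrightarrow> 0 < k \<and> distinct L \<and> (\<forall>(u, v)\<in>set L. u < k \<and> v < k \<and> (v, u) \<notin> set L)
     \<and> (\<forall>v\<in>set [1..<k]. \<exists>u\<in>set (adj_list L v). u < v)"

lemma star_ext_pair_graph:
  assumes "core_list L k" "k \<le> n"
  shows "pair_graph (star_ext L k n)"
  unfolding star_ext_def
  using assms by (intro pair_graph_ugraph) (force simp: core_list_def)+

lemma star_ext_connected_with_edges:
  assumes L: "core_list L k" and "k \<le> n" and m: "m = length L + (n - k)"
  shows "connected_with_edges m (star_ext L k n)"
proof -
  have "connected (with_proj (star_ext L k n))"
    unfolding star_ext_def
  proof (rule connected_ugraph)
    show "pair_graph (ugraph n (set L \<union> {0} \<times> {k..<n}))"
      using star_ext_pair_graph[OF assms(1,2)] by (simp add: star_ext_def)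
    show "0 < n" using assms by (auto simp: core_list_def)
    fix v assume v: "0 < v" "v < n"
    show "\<exists>u<v. (u, v) \<in> set L \<union> {0} \<times> {k..<n} \<union> (set L \<union> {0} \<times> {k..<n})\<inverse>"
    proof (cases "v < k")
      case True
      then have "v \<in> set [1..<k]" using v by simp
      then obtain u where "u < v" "u \<in> set (adj_list L v)" using L unfolding core_list_def by blast
      then show ?thesis by (auto simp: set_adj_list)
    qed (use v in auto)
  qed
  moreover have "card (uedges (star_ext L k n)) = length L + (n - k)"
  proof -
    have "set L \<inter> {0} \<times> {k..<n} = {}" using L by (auto simp: core_list_def)
    then have "card (set L \<union> {0::nat} \<times> {k..<n}) = length L + (n - k)"
      using L by (simp add: card_Un_disjoint distinct_card core_list_def)
    moreover have "card (uedges (star_ext L k n)) = card (set L \<union> {0} \<times> {k..<n})"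
      unfolding star_ext_def using L by (intro card_uedges_ugraph) (auto simp: core_list_def)
    ultimately show ?thesis by simp
  qed
  ultimately show ?thesis
    using star_ext_pair_graph[OF assms(1,2)] m by (simp add: connected_with_edges_def)
qed

text \<open>The equation at a pendant vertex forces its entry to be \<open>x 0 / (t - 1)\<close>, so
  only the core entries have to be supplied. Each pendant vertex then contributes
  \<open>x 0 * t / (t - 1)\<close> to the sum at the center; \<open>center\<close> is the equation
  at \<open>0\<close> multiplied by \<open>t - 1\<close>.\<close>

lemma star_ext_q_index:
  assumes L: "core_list L k" and "k \<le> n" and "t > 1"
    and pos: "\<forall>v\<in>set [0..<k]. x v > 0"
    and core: "\<forall>v\<in>set [1..<k]. (\<Sum>u\<in>set (adj_list L v). x v + x u) = t * x v"
    and center: "(\<Sum>u\<in>set (adj_list L 0). x 0 + x u) * (t - 1) + real (n - k) * (x 0 * t) = t * x 0 * (t - 1)"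
  shows "q_index (star_ext L k n) = t"
proof -
  let ?G = "star_ext L k n"
  interpret pair_graph ?G using star_ext_pair_graph L \<open>k \<le> n\<close> by blast
  have k: "0 < k" and Lk: "\<And>u v. (u, v) \<in> set L \<Longrightarrow> u < k \<and> v < k"
    using L by (auto simp: core_list_def)
  have lt: "u < k" if "u \<in> set (adj_list L v)" for u v
    using that Lk by (auto simp: set_adj_list)
  define y where "y v = (if v < k then x v else x 0 / (t - 1))" for v
  have y0: "y 0 = x 0" using k by (simp add: y_def)
  have sum_y: "(\<Sum>u\<in>set (adj_list L v). y v + y u) = (\<Sum>u\<in>set (adj_list L v). x v + x u)"
    if "v < k" for v
    using that lt by (intro sum.cong) (auto simp: y_def)
  show ?thesis
  proof (rule q_index_eqI)
    show "pverts ?G \<noteq> {}" using k \<open>k \<le> n\<close> by (auto simp: star_ext_def ugraph_def lessThan_empty_iff)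
    show "y v > 0" if "v \<in> pverts ?G" for v
      using that pos k \<open>t > 1\<close> by (auto simp: y_def)
    fix v assume "v \<in> pverts ?G"
    then have v: "v < n" by (simp add: star_ext_def ugraph_def)
    consider "v = 0" | "0 < v" "v < k" | "k \<le> v" by linarith
    then show "(\<Sum>u\<in>nbrs v. y v + y u) = t * y v"
    proof cases
      case 1
      have "nbrs 0 = set (adj_list L 0) \<union> {k..<n}"
        using k by (auto simp: set_adj_list star_ext_def ugraph_def)
      moreover have "set (adj_list L 0) \<inter> {k..<n} = {}" using lt by force
      ultimately have "(\<Sum>u\<in>nbrs 0. y 0 + y u)
          = (\<Sum>u\<in>set (adj_list L 0). y 0 + y u) + (\<Sum>u\<in>{k..<n}. y 0 + y u)"
        by (simp only: sum.union_disjoint[OF finite_set finite_atLeastLessThan])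
      also have "(\<Sum>u\<in>{k..<n}. y 0 + y u) = (\<Sum>u\<in>{k..<n}. x 0 * t / (t - 1))"
        using \<open>t > 1\<close> k by (intro sum.cong) (auto simp: y_def field_simps)
      finally have "(\<Sum>u\<in>nbrs 0. y 0 + y u) * (t - 1) = t * x 0 * (t - 1)"
        using center k sum_y[of 0] \<open>t > 1\<close> by (simp add: distrib_right)
      then show ?thesis using y0 1 \<open>t > 1\<close> by simp
    next
      case 2
      have "nbrs v = set (adj_list L v)"
        using 2 by (auto simp: set_adj_list star_ext_def ugraph_def)
      then show ?thesis using core 2 sum_y[of v] by (simp add: y_def)
    next
      case 3
      have "nbrs v = {0}"
        using 3 v k by (auto simp: set_adj_list star_ext_def ugraph_def dest: Lk)
      then show ?thesis using 3 k \<open>t > 1\<close> by (simp add: y_def field_simps)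
    qed
  qed
qed

text \<open>Position \<open>i\<close> of \<open>ws\<close> names the vertex playing the role of core
  vertex \<open>i\<close>, and \<open>S\<close> collects the pendant vertices. Listing
  \<open>S\<close> after \<open>ws\<close> gives a bijection \<open>g\<close> from
  \<open>{..<n}\<close> onto the vertices that carries the edges of the model to those of
  \<open>G\<close>.\<close>

lemma digraph_iso_star_ext:
  fixes G :: "'a pair_pre_digraph"
  assumes G: "pair_graph G" and L: "core_list L k"
    and ws: "distinct ws" "length ws = k"
    and S: "finite S" "S \<inter> set ws = {}" "pverts G = set ws \<union> S" "n = k + card S"
    and edges: "uedges G = (\<lambda>(i, j). {ws ! i, ws ! j}) ` set L \<union> (\<lambda>s. {ws ! 0, s}) ` S"
  shows "digraph_iso (with_proj G) (with_proj (star_ext L k n))"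
proof -
  interpret pair_graph G by fact
  obtain ls where ls: "distinct ls" "set ls = S" using finite_distinct_list[OF S(1)] by blast
  have len: "length ls = card S" using ls distinct_card by fastforce
  let ?zs = "ws @ ls" and ?E = "set L \<union> {0} \<times> {k..<n}"
  define g where "g = nth ?zs"
  have Lk: "0 < k" "\<And>u v. (u, v) \<in> set L \<Longrightarrow> u < k \<and> v < k"
    using L by (auto simp: core_list_def)
  have bij: "bij_betw g {..<n} (pverts G)"
    unfolding g_def by (rule bij_betw_nth) (use ws S ls len in auto)
  have gk: "g ` {k..<n} = S"
  proof -
    have "{k..<n} = (\<lambda>i. k + i) ` {..<card S}"
      using S(4) by (simp add: lessThan_atLeast0 add.commute)
    then have "g ` {k..<n} = (\<lambda>i. g (k + i)) ` {..<card S}" by (simp only: image_image)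
    also have "\<dots> = (\<lambda>i. ls ! i) ` {..<card S}"
      using ws(2) by (intro image_cong) (auto simp: g_def nth_append)
    also have "\<dots> = S" using ls len by (metis (no_types) bij_betw_imp_surj_on bij_betw_nth)
    finally show ?thesis .
  qed
  have E: "?E \<subseteq> {..<n} \<times> {..<n}" using Lk S(4) by force
  have "g i = ws ! i" if "i < k" for i using that ws by (simp add: g_def nth_append)
  with Lk have "(\<lambda>(i, j). {ws ! i, ws ! j}) ` set L = (\<lambda>(i, j). {g i, g j}) ` set L" "ws ! 0 = g 0"
    by (auto intro!: image_cong)
  then have "uedges G = (\<lambda>(i, j). {g i, g j}) ` set L \<union> (\<lambda>s. {g 0, s}) ` g ` {k..<n}"
    unfolding edges gk by simp
  also have "\<dots> = (\<lambda>(i, j). {g i, g j}) ` ?E" by auto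
  finally have edges': "uedges G = (\<lambda>(i, j). {g i, g j}) ` ?E" .
  \<comment> \<open>By symmetry the arcs are determined by the undirected edges, so the description
    of \<open>uedges G\<close> settles \<open>parcs G\<close>.\<close>
  have arc: "(a, b) \<in> parcs G \<longleftrightarrow> {a, b} \<in> uedges G" for a b
    using arcs_symmetric by (auto simp: uedges_def doubleton_eq_iff)
  have arcs: "parcs G = map_prod g g ` (?E \<union> ?E\<inverse>)"
  proof -
    have "(a, b) \<in> map_prod g g ` (?E \<union> ?E\<inverse>)" if "(a, b) \<in> parcs G" for a b
      using that unfolding arc edges' by (force simp: doubleton_eq_iff)
    moreover have "(g i, g j) \<in> parcs G" if "(i, j) \<in> ?E \<union> ?E\<inverse>" for i j
      using that unfolding arc edges' by (force simp: insert_commute)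
    ultimately show ?thesis by auto
  qed
  \<comment> \<open>The isomorphism runs from \<open>G\<close> to the model, so it is the inverse of
    \<open>g\<close>; arcs are pairs and are mapped componentwise.\<close>
  define f where "f = the_inv_into {..<n} g"
  have inj: "inj_on g {..<n}" using bij by (simp add: bij_betw_def)
  have fg: "f (g i) = i" if "i < n" for i using inj that by (simp add: f_def the_inv_into_f_f)
  have finj: "inj_on f (pverts G)" and fimg: "f ` pverts G = {..<n}"
    using bij_betw_the_inv_into[OF bij] by (auto simp: f_def bij_betw_def)
  let ?h = "\<lparr>iso_verts = f, iso_arcs = map_prod f f, iso_head = snd, iso_tail = fst\<rparr>
    :: ('a, 'a \<times> 'a, nat, nat \<times> nat) digraph_isomorphism"
  have "inj_on (map_prod f f) (parcs G)"
    by (rule inj_on_subset[OF map_prod_inj_on[OF finj finj]]) (use in_arcsD1 in_arcsD2 in auto)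
  then have "digraph_isomorphism ?h"
    using finj unfolding digraph_isomorphism_def by (auto simp: wf_digraph_wp_iff)
  moreover have "map_prod f f ` parcs G = ?E \<union> ?E\<inverse>"
  proof -
    have "(map_prod f f \<circ> map_prod g g) p = p" if "p \<in> ?E \<union> ?E\<inverse>" for p
    proof -
      have "fst p < n" "snd p < n" using that E by auto
      then show ?thesis by (cases p) (simp add: fg)
    qed
    then have "(map_prod f f \<circ> map_prod g g) ` (?E \<union> ?E\<inverse>) = id ` (?E \<union> ?E\<inverse>)"
      by (intro image_cong refl) (simp only: id_apply)
    then show ?thesis unfolding arcs image_comp by simp
  qed
  then have "with_proj (star_ext L k n) = app_iso ?h (with_proj G)"
    by (simp add: app_iso_def with_proj_def star_ext_def ugraph_def fimg)
  ultimately show ?thesis unfolding digraph_iso_def by blast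
qed

section \<open>Graphs of small maximum degree\<close>

context pair_graph
begin

section \<open>Degree counting and cuts\<close>

lemma uedges_iff: "{a, b} \<in> uedges G \<longleftrightarrow> b \<in> nbrs a"
  using arcs_symmetric by (auto simp: uedges_def doubleton_eq_iff)

lemma uedgesE:
  assumes "e \<in> uedges G"
  obtains a b where "e = {a, b}" "b \<in> nbrs a" "a \<noteq> b" "a \<in> pverts G" "b \<in> pverts G"
  using assms in_arcsD1 in_arcsD2 no_loops' by (fastforce simp: uedges_def)

lemma finite_uedges: "finite (uedges G)"
  using pair_finite_arcs by (simp add: uedges_def)

lemma incident_uedges: "{e \<in> uedges G. v \<in> e} = (\<lambda>u. {v, u}) ` nbrs v"
proof (rule Set.set_eqI, rule iffI)
  fix e assume "e \<in> {e \<in> uedges G. v \<in> e}"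
  then obtain a b where "e = {a, b}" "b \<in> nbrs a" "v = a \<or> v = b" by (auto elim: uedgesE)
  then show "e \<in> (\<lambda>u. {v, u}) ` nbrs v" using nbrs_sym by (auto simp: insert_commute)
qed (auto simp: uedges_iff)

lemma card_incident_uedges: "card {e \<in> uedges G. v \<in> e} = card (nbrs v)"
  unfolding incident_uedges by (intro card_image) (auto simp: inj_on_def doubleton_eq_iff)

text \<open>Double counting of the incidences between edges and the vertices of
  \<open>S\<close>.\<close>

lemma sum_card_nbrs:
  assumes "finite S"
  shows "(\<Sum>u\<in>S. card (nbrs u)) = (\<Sum>e\<in>uedges G. card (e \<inter> S))"
proof -
  have "(\<Sum>u\<in>S. card (nbrs u)) = (\<Sum>u\<in>S. \<Sum>e\<in>uedges G. if u \<in> e then 1 else 0)"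
    by (simp flip: card_incident_uedges sum.inter_filter[OF finite_uedges])
  also have "\<dots> = (\<Sum>e\<in>uedges G. \<Sum>u\<in>S. if u \<in> e then 1 else 0)" by (rule sum.swap)
  also have "\<dots> = (\<Sum>e\<in>uedges G. card (e \<inter> S))"
    using assms by (simp flip: sum.inter_filter add: Int_def conj_commute)
  finally show ?thesis .
qed

lemma card_uedge_Int_le: "e \<in> uedges G \<Longrightarrow> card (e \<inter> S) \<le> 2"
proof -
  assume "e \<in> uedges G"
  then obtain a b where e: "e = {a, b}" "a \<noteq> b" by (auto elim: uedgesE)
  have "card (e \<inter> S) \<le> card e" using e by (intro card_mono) auto
  then show ?thesis using e by simp
qed

text \<open>With \<open>m\<close> edges and \<open>d = card (nbrs v)\<close>, each of the
  \<open>d\<close> edges at \<open>v\<close> has exactly one end in \<open>nbrs v\<close>, and each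
  of the \<open>m - d\<close> others at most two. The degrees over \<open>nbrs v\<close> therefore
  sum to at most \<open>2 * (m - d) + d\<close>.\<close>

lemma sum_card_nbrs_nbrs_le:
  "(\<Sum>u\<in>nbrs v. card (nbrs u)) + card (nbrs v) \<le> 2 * card (uedges G)"
proof -
  let ?I = "{e \<in> uedges G. v \<in> e}"
  have "(\<Sum>e\<in>uedges G. card (e \<inter> nbrs v)) = (\<Sum>e\<in>uedges G - ?I. card (e \<inter> nbrs v)) + (\<Sum>e\<in>?I. card (e \<inter> nbrs v))"
    by (rule sum.subset_diff) (auto simp: finite_uedges)
  also have "(\<Sum>e\<in>?I. card (e \<inter> nbrs v)) = (\<Sum>e\<in>?I. 1)"
  proof (rule sum.cong)
    fix e assume "e \<in> ?I"
    then obtain u where "u \<in> nbrs v" "e = {v, u}" unfolding incident_uedges by blast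
    then have "e \<inter> nbrs v = {u}" using nbrs_irrefl by auto
    then show "card (e \<inter> nbrs v) = 1" by simp
  qed simp
  also have "(\<Sum>e\<in>uedges G - ?I. card (e \<inter> nbrs v)) \<le> (\<Sum>e\<in>uedges G - ?I. 2)"
    by (intro sum_mono card_uedge_Int_le) auto
  finally have "(\<Sum>e\<in>uedges G. card (e \<inter> nbrs v)) \<le> 2 * card (uedges G - ?I) + card ?I" by simp
  moreover have "card (uedges G - ?I) + card ?I = card (uedges G)"
    by (subst card_Diff_subset) (auto simp: finite_uedges card_mono)
  ultimately show ?thesis
    unfolding sum_card_nbrs[OF finite_nbrs] card_incident_uedges[of v] by linarith
qed

text \<open>The edges at \<open>a\<close> and the edges at \<open>b\<close> have at most the edge
  \<open>{a, b}\<close> in common.\<close>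

lemma card_nbrs_add_le:
  assumes "a \<noteq> b"
  shows "card (nbrs a) + card (nbrs b) \<le> card (uedges G) + 1"
proof -
  let ?I = "\<lambda>v. {e \<in> uedges G. v \<in> e}"
  have fin: "finite (?I v)" for v using finite_uedges by simp
  have "?I a \<inter> ?I b \<subseteq> {{a, b}}" using assms by (auto elim!: uedgesE)
  then have "card (?I a \<inter> ?I b) \<le> 1" by (metis card_mono finite.emptyI finite_insert is_singletonI is_singleton_altdef)
  moreover have "card (?I a \<union> ?I b) \<le> card (uedges G)"
    by (intro card_mono finite_uedges) auto
  ultimately show ?thesis
    using card_Un_Int[OF fin fin, of a b] unfolding card_incident_uedges by linarith
qed

lemma connected_cut:
  assumes "connected (with_proj G)" "S \<subseteq> pverts G" "S \<noteq> {}" "S \<noteq> pverts G"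
  obtains a b where "a \<in> S" "b \<notin> S" "b \<in> nbrs a"
proof -
  obtain u v where uv: "u \<in> S" "v \<in> pverts G" "v \<notin> S" using assms by blast
  have "(u, v) \<in> rtrancl_on (pverts G) (parcs G)"
  proof -
    have "u \<rightarrow>\<^sup>*\<^bsub>with_proj G\<^esub> v"
      using symmetric_connected_imp_strongly_connected[OF sym_arcs assms(1)] uv assms(2)
      by (auto simp: strongly_connected_def)
    then show ?thesis by (simp add: reachable_def)
  qed
  then have "u \<in> S \<longrightarrow> v \<in> S \<or> (\<exists>a b. a \<in> S \<and> b \<notin> S \<and> b \<in> nbrs a)"
    by (induction rule: rtrancl_on.induct) auto
  then show thesis using that uv by blast
qed

lemma nbrs_nonempty:
  assumes "connected (with_proj G)" "uedges G \<noteq> {}" "v \<in> pverts G"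
  shows "nbrs v \<noteq> {}"
proof -
  obtain a b where "a \<noteq> b" "a \<in> pverts G" "b \<in> pverts G" using assms(2) by (meson equals0I uedgesE)
  then have "pverts G \<noteq> {v}" by auto
  then show ?thesis using connected_cut[OF assms(1), of "{v}"] assms(3) by blast
qed

lemma q_index_le_max_degree_small:
  assumes conn: "connected (with_proj G)" and m: "card (uedges G) = m" "m \<ge> 9"
    and deg: "\<And>v. v \<in> pverts G \<Longrightarrow> card (nbrs v) \<le> m - 3"
  shows "q_index G \<le> real m - 1"
proof (rule q_index_le[where y = "\<lambda>v. real (card (nbrs v))"])
  have ne: "uedges G \<noteq> {}" using m by auto
  show "pverts G \<noteq> {}" using ne by (auto elim: uedgesE)
  show pos: "real (card (nbrs v)) > 0" if "v \<in> pverts G" for v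
    using nbrs_nonempty[OF conn ne that] finite_nbrs by (simp add: card_gt_0_iff)
  fix v assume v: "v \<in> pverts G"
  define d s where "d = card (nbrs v)" and "s = (\<Sum>u\<in>nbrs v. card (nbrs u))"
  \<comment> \<open>This is the test inequality at \<open>v\<close> for the degree vector, with
    \<open>c = m - 1\<close>.\<close>
  have "d * d + s \<le> (m - 1) * d"
  proof -
    have "d > 0" "d \<le> m - 3" using pos[OF v] deg[OF v] by (auto simp: d_def)
    then consider "d = 1" | "d = 2" | "d \<ge> 3" by linarith
    then show ?thesis
    proof cases
      case 1
      \<comment> \<open>For a leaf, \<open>s\<close> is the degree of its only neighbour, so
        \<open>1 + s \<le> m - 2\<close>.\<close>
      then obtain u where "nbrs v = {u}" unfolding d_def by (meson card_1_singletonE)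
      then have "s \<le> m - 3" using deg[of u] nbrs_subset[of v] by (simp add: s_def)
      then show ?thesis using 1 m by simp
    next
      case 2
      then obtain a b where "nbrs v = {a, b}" "a \<noteq> b" unfolding d_def by (meson card_2_iff)
      \<comment> \<open>The claim becomes \<open>4 + (m + 1) \<le> 2 * (m - 1)\<close>.\<close>
      then have "s \<le> m + 1" using card_nbrs_add_le[of a b] m by (simp add: s_def)
      then show ?thesis using 2 m by simp
    next
      case 3
      have "s + d \<le> 2 * m" using sum_card_nbrs_nbrs_le[of v] m by (simp add: s_def d_def)
      \<comment> \<open>By the bound on \<open>s + d\<close> it is enough that
        \<open>d * d + 2 * m \<le> m * d\<close>. With \<open>d = 3 + i\<close> and
        \<open>m = d + 3 + j\<close> this reads \<open>3 \<le> i * j + i + j\<close>, which follows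
        from \<open>i + j = m - 6 \<ge> 3\<close>.\<close>
      moreover obtain i where i: "d = 3 + i" using le_Suc_ex[OF 3] by blast
      moreover have "d + 3 \<le> m" using \<open>d \<le> m - 3\<close> m by linarith
      then obtain j where j: "m = d + 3 + j" using le_Suc_ex by blast
      ultimately show ?thesis using m by (simp add: algebra_simps)
    qed
  qed
  then have "real (d * d + s) \<le> real ((m - 1) * d)" by (rule of_nat_mono)
  then show "(\<Sum>u\<in>nbrs v. real (card (nbrs v)) + real (card (nbrs u))) \<le> (real m - 1) * real (card (nbrs v))"
    using m by (simp add: sum.distrib d_def s_def of_nat_diff)
qed

end

section \<open>Graphs of large maximum degree\<close>

lemma extremal_graphs_star_ext:
  "graph_K1 m = star_ext [] 1 (m + 1)"
  "graph_G03 m = star_ext [(0,1), (1,2), (2,0)] 3 m"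
  "graph_T1 m = star_ext [(0,1), (1,2)] 3 (m + 1)"
  "graph_B1 m = star_ext [(0,1), (1,2), (2,0), (1,3), (3,0)] 4 (m - 1)"
  "graph_B2 m = star_ext [(0,1), (1,2), (2,0), (0,3), (3,4), (4,0)] 5 (m - 1)"
  "graph_G13 m = star_ext [(0,1), (1,2), (2,0), (1,3)] 4 m"
  "graph_Gv3 m = star_ext [(0,1), (1,2), (2,0), (0,3), (3,4)] 5 m"
  "graph_T2 m = star_ext [(0,1), (1,2), (1,3)] 4 (m + 1)"
  "graph_G04 m = star_ext [(0,1), (1,2), (2,3), (3,0)] 4 m"
  "graph_T3 m = star_ext [(0,1), (1,2), (0,3), (3,4)] 5 (m + 1)"
  "graph_T4 m = star_ext [(0,1), (1,2), (2,3)] 4 (m + 1)"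
  by (simp_all add: star_ext_def graph_K1_def graph_G03_def graph_T1_def graph_B1_def graph_B2_def
      graph_G13_def graph_Gv3_def graph_T2_def graph_G04_def graph_T3_def graph_T4_def
      atLeastLessThanSuc_atLeastAtMost)

lemma core_lists:
  "core_list [] 1"
  "core_list [(0,1), (1,2), (2,0)] 3"
  "core_list [(0,1), (1,2)] 3"
  "core_list [(0,1), (1,2), (2,0), (1,3), (3,0)] 4"
  "core_list [(0,1), (1,2), (2,0), (0,3), (3,4), (4,0)] 5"
  "core_list [(0,1), (1,2), (2,0), (1,3)] 4"
  "core_list [(0,1), (1,2), (2,0), (0,3), (3,4)] 5"
  "core_list [(0,1), (1,2), (1,3)] 4"
  "core_list [(0,1), (1,2), (2,3), (3,0)] 4"
  "core_list [(0,1), (1,2), (0,3), (3,4)] 5"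
  "core_list [(0,1), (1,2), (2,3)] 4"
  by (simp_all add: core_list_def adj_list_def upt_rec)

lemma extremal_connected_with_edges:
  assumes "m \<ge> 6"
  shows "connected_with_edges m (graph_K1 m)" "connected_with_edges m (graph_G03 m)"
    "connected_with_edges m (graph_T1 m)" "connected_with_edges m (graph_B1 m)"
    "connected_with_edges m (graph_B2 m)" "connected_with_edges m (graph_G13 m)"
    "connected_with_edges m (graph_Gv3 m)" "connected_with_edges m (graph_T2 m)"
    "connected_with_edges m (graph_G04 m)" "connected_with_edges m (graph_T3 m)"
    "connected_with_edges m (graph_T4 m)"
  unfolding extremal_graphs_star_ext
  by (intro star_ext_connected_with_edges core_lists; use assms in simp)+

section \<open>Classification by the edges that avoid a vertex\<close>

context pair_graph
begin

definition far_edges :: "'a \<Rightarrow> 'a set set" where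
  "far_edges v = {e \<in> uedges G. v \<notin> e}"

lemma uedges_split: "uedges G = far_edges v \<union> (\<lambda>u. {v, u}) ` nbrs v"
  using incident_uedges[of v] by (auto simp: far_edges_def)

lemma card_far_edges: "card (nbrs v) + card (far_edges v) = card (uedges G)"
proof -
  have "uedges G = {e \<in> uedges G. v \<in> e} \<union> far_edges v" by (auto simp: far_edges_def)
  moreover have "card ({e \<in> uedges G. v \<in> e} \<union> far_edges v) = card (nbrs v) + card (far_edges v)"
    unfolding card_incident_uedges[symmetric]
    by (rule card_Un_disjoint) (auto simp: finite_uedges far_edges_def)
  ultimately show ?thesis by simp
qed

lemma finite_far_edges: "finite (far_edges v)"
  using finite_uedges by (simp add: far_edges_def)

lemma far_edgesE:
  assumes "e \<in> far_edges v"
  obtains a b where "e = {a, b}" "a \<noteq> b" "a \<noteq> v" "b \<noteq> v" "a \<in> pverts G" "b \<in> pverts G"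
  using assms by (auto simp: far_edges_def elim!: uedgesE)

text \<open>A connected graph with an edge has no isolated vertex, so its edges cover all vertices,
  and each edge either contains \<open>v\<close> or is far.\<close>

lemma pverts_split:
  assumes conn: "connected (with_proj G)" "uedges G \<noteq> {}" and v: "v \<in> pverts G"
  shows "pverts G = insert v (nbrs v \<union> \<Union>(far_edges v))"
proof (rule equalityI; rule subsetI)
  fix u assume "u \<in> pverts G"
  then obtain w where "w \<in> nbrs u" using nbrs_nonempty[OF conn] by blast
  then have "{u, w} \<in> uedges G" by (simp add: uedges_iff)
  then show "u \<in> insert v (nbrs v \<union> \<Union>(far_edges v))"
    unfolding uedges_split[of v] by (auto simp: doubleton_eq_iff)
qed (use v nbrs_subset in \<open>auto elim: far_edgesE\<close>)

text \<open>If \<open>v\<close> and its neighbours are all the vertices, any far edge will do.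
  Otherwise some edge leaves this set; it cannot start at \<open>v\<close>, so it is a far edge with
  an end adjacent to \<open>v\<close>.\<close>

lemma far_edges_meet_nbrs:
  assumes conn: "connected (with_proj G)" and v: "v \<in> pverts G" and ne: "far_edges v \<noteq> {}"
  obtains e where "e \<in> far_edges v" "e \<inter> nbrs v \<noteq> {}"
proof (cases "insert v (nbrs v) = pverts G")
  case True
  obtain e where "e \<in> far_edges v" using ne by blast
  moreover then have "e \<inter> nbrs v \<noteq> {}" by (rule far_edgesE) (use True in auto)
  ultimately show ?thesis using that by blast
next
  case False
  obtain x y where xy: "x \<in> insert v (nbrs v)" "y \<notin> insert v (nbrs v)" "y \<in> nbrs x"
    using connected_cut[OF conn _ _ False] v nbrs_subset by blast
  then have "x \<in> nbrs v" by auto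
  moreover have "{x, y} \<in> far_edges v" using xy nbrs_irrefl by (auto simp: far_edges_def uedges_iff)
  ultimately show ?thesis using that by blast
qed

text \<open>Some edge joins \<open>f\<close> to the remaining vertices. Since no end of
  \<open>f\<close> is \<open>v\<close> or adjacent to \<open>v\<close>, that edge avoids
  \<open>v\<close>; it differs from \<open>f\<close>, so it is \<open>e\<close>.\<close>

lemma far_edges_meet_each_other:
  assumes conn: "connected (with_proj G)" and v: "v \<in> pverts G"
    and R: "far_edges v = {e, f}" and f: "f \<inter> nbrs v = {}"
  shows "e \<inter> f \<noteq> {}"
proof -
  have "f \<in> far_edges v" using R by simp
  then obtain a b where ab: "f = {a, b}" "a \<noteq> v" "b \<noteq> v" "f \<subseteq> pverts G" by (auto elim!: far_edgesE)
  then obtain x y where xy: "x \<in> pverts G - f" "y \<notin> pverts G - f" "y \<in> nbrs x"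
    using connected_cut[OF conn, of "pverts G - f"] v by blast
  then have y: "y \<in> f" using nbrs_subset by auto
  have "{x, y} \<in> uedges G" using xy by (simp add: uedges_iff)
  moreover have "{x, y} \<notin> (\<lambda>u. {v, u}) ` nbrs v"
    using y f ab xy by (auto simp: doubleton_eq_iff)
  ultimately have "{x, y} \<in> far_edges v" unfolding uedges_split[of v] by simp
  then have "{x, y} = e" using R xy y by auto
  then show ?thesis using y by auto
qed

text \<open>The core consists of \<open>v\<close>, all ends of far edges, and the edges among them;
  \<open>T\<close> holds the core vertices adjacent to \<open>v\<close>, and the other neighbours of
  \<open>v\<close> are the pendant vertices. The condition on \<open>n\<close> is
  \<open>n = k + (card (nbrs v) - card T)\<close> without subtraction.\<close>

lemma digraph_iso_core:
  assumes conn: "connected (with_proj G)" "uedges G \<noteq> {}" and v: "v \<in> pverts G"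
    and L: "core_list L k"
    and ws: "distinct ws" "length ws = k" "ws ! 0 = v" "set ws \<subseteq> pverts G" "\<Union>(far_edges v) \<subseteq> set ws"
    and T: "nbrs v \<inter> set ws = T" "n + card T = k + card (nbrs v)"
    and edges: "(\<lambda>(i, j). {ws ! i, ws ! j}) ` set L = far_edges v \<union> (\<lambda>u. {v, u}) ` T"
  shows "digraph_iso (with_proj G) (with_proj (star_ext L k n))"
proof (rule digraph_iso_star_ext[OF _ L ws(1,2)])
  have nb: "nbrs v = T \<union> (nbrs v - set ws)" using T by auto
  show "pair_graph G" ..
  show "finite (nbrs v - set ws)" using finite_nbrs by simp
  show "(nbrs v - set ws) \<inter> set ws = {}" by auto
  have "0 < k" using L by (simp add: core_list_def)
  then have "v \<in> set ws" using ws by (metis nth_mem)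
  then show "pverts G = set ws \<union> (nbrs v - set ws)"
    using ws pverts_split[OF conn v] by auto
  have "card (nbrs v) = card T + card (nbrs v - set ws)"
    using T finite_nbrs[of v] by (subst nb, subst card_Un_disjoint) auto
  then show "n = k + card (nbrs v - set ws)" using T by simp
  show "uedges G = (\<lambda>(i, j). {ws ! i, ws ! j}) ` set L \<union> (\<lambda>s. {ws ! 0, s}) ` (nbrs v - set ws)"
    unfolding edges uedges_split[of v] ws(3) by (subst nb) auto
qed

text \<open>The degree bound leaves at most two far edges. The cases are their number, whether they
  share a vertex, and which of their ends are adjacent to \<open>v\<close>; connectedness excludes
  patterns detached from \<open>v\<close>.\<close>

lemma digraph_iso_extremal:
  assumes conn: "connected (with_proj G)" and m: "card (uedges G) = m" "m > 2"
    and v: "v \<in> pverts G" and deg: "card (nbrs v) \<ge> m - 2"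
  shows "\<exists>H\<in>{graph_K1 m, graph_G03 m, graph_T1 m, graph_B1 m, graph_B2 m, graph_G13 m, graph_Gv3 m,
     graph_T2 m, graph_G04 m, graph_T3 m, graph_T4 m}. digraph_iso (with_proj G) (with_proj H)"
    (is ?iso)
proof -
  let ?N = "nbrs v" and ?R = "far_edges v"
  have ne: "uedges G \<noteq> {}" using m by auto
  have nv: "v \<notin> ?N" by (rule nbrs_irrefl)
  have N: "?N \<subseteq> pverts G" by (rule nbrs_subset)
  note iso = digraph_iso_core[OF conn ne v]
  have "card ?R \<le> 2" "card ?N + card ?R = m" using card_far_edges[of v] m deg by auto
  then consider "?R = {}" | e where "?R = {e}" | e f where "?R = {e, f}" "e \<noteq> f"
    using finite_far_edges[of v]
    by (metis One_nat_def card_0_eq card_1_singletonE card_2_iff le_SucE le_zero_eq numeral_2_eq_2)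
  then show ?iso
  proof cases
    case 1
    then have "card ?N = m" using card_far_edges[of v] m by simp
    then have "digraph_iso (with_proj G) (with_proj (graph_K1 m))"
      unfolding extremal_graphs_star_ext
      by (intro iso[where ws = "[v]" and T = "{}"] core_lists) (use 1 nv v in auto)
    then show ?thesis by blast
  next
    case (2 e)
    then have card: "card ?N = m - 1" using card_far_edges[of v] m by simp
    obtain a b where e: "e = {a, b}" "a \<noteq> b" "a \<noteq> v" "b \<noteq> v" "a \<in> pverts G" "b \<in> pverts G" "a \<in> ?N"
    proof -
      have "e \<in> ?R" "e \<inter> ?N \<noteq> {}" using far_edges_meet_nbrs[OF conn v] 2 by auto
      then show thesis using that by (auto elim!: far_edgesE)
    qed
    show ?thesis
    proof (cases "b \<in> ?N")
      case True
      then have "digraph_iso (with_proj G) (with_proj (graph_G03 m))"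
        unfolding extremal_graphs_star_ext
        by (intro iso[where ws = "[v, a, b]" and T = "{a, b}"] core_lists)
          (use 2 nv v e card m in auto)
      then show ?thesis by blast
    next
      case False
      then have "digraph_iso (with_proj G) (with_proj (graph_T1 m))"
        unfolding extremal_graphs_star_ext
        by (intro iso[where ws = "[v, a, b]" and T = "{a}"] core_lists)
          (use 2 nv v e card m in auto)
      then show ?thesis by blast
    qed
  next
    case (3 e f)
    then have card: "card ?N = m - 2" using card_far_edges[of v] m by simp
    \<comment> \<open>One fact per pattern of two far edges. A shared end is \<open>a\<close> in the
      patterns \<open>B1\<close>, \<open>G13\<close>, \<open>T2\<close> and \<open>b\<close> in
      \<open>G04\<close>, \<open>T4\<close>; the far edges of \<open>B2\<close>, \<open>Gv3\<close>,
      \<open>T3\<close> are disjoint.\<close>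
    have B1: ?iso
      if "?R = {{a, b}, {a, c}}" "distinct [v, a, b, c]" "{a, b, c} \<subseteq> pverts G" "a \<in> ?N" "b \<in> ?N" "c \<in> ?N" for a b c
    proof -
      have "digraph_iso (with_proj G) (with_proj (graph_B1 m))"
        unfolding extremal_graphs_star_ext
        by (intro iso[where ws = "[v, a, b, c]" and T = "{a, b, c}"] core_lists)
          (use that card \<open>m > 2\<close> nv v in \<open>simp_all add: insert_commute\<close>)
      then show ?thesis by blast
    qed
    have B2: ?iso
      if "?R = {{a, b}, {c, d}}" "distinct [v, a, b, c, d]" "{a, b, c, d} \<subseteq> pverts G" "a \<in> ?N" "b \<in> ?N" "c \<in> ?N" "d \<in> ?N" for a b c d
    proof -
      have "digraph_iso (with_proj G) (with_proj (graph_B2 m))"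
        unfolding extremal_graphs_star_ext
        by (intro iso[where ws = "[v, a, b, c, d]" and T = "{a, b, c, d}"] core_lists)
          (use that card \<open>m > 2\<close> nv v in \<open>simp_all add: insert_commute\<close>)
      then show ?thesis by blast
    qed
    have G13: ?iso
      if "?R = {{a, b}, {a, c}}" "distinct [v, a, b, c]" "{a, b, c} \<subseteq> pverts G" "a \<in> ?N" "b \<in> ?N" "c \<notin> ?N" for a b c
    proof -
      have "digraph_iso (with_proj G) (with_proj (graph_G13 m))"
        unfolding extremal_graphs_star_ext
        by (intro iso[where ws = "[v, a, b, c]" and T = "{a, b}"] core_lists)
          (use that card \<open>m > 2\<close> nv v in \<open>simp_all add: insert_commute\<close>)
      then show ?thesis by blast
    qed
    have Gv3: ?iso
      if "?R = {{a, b}, {c, d}}" "distinct [v, a, b, c, d]" "{a, b, c, d} \<subseteq> pverts G" "a \<in> ?N" "b \<in> ?N" "c \<in> ?N" "d \<notin> ?N" for a b c d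
    proof -
      have "digraph_iso (with_proj G) (with_proj (graph_Gv3 m))"
        unfolding extremal_graphs_star_ext
        by (intro iso[where ws = "[v, a, b, c, d]" and T = "{a, b, c}"] core_lists)
          (use that card \<open>m > 2\<close> nv v in \<open>simp_all add: insert_commute\<close>)
      then show ?thesis by blast
    qed
    have T2: ?iso
      if "?R = {{a, b}, {a, c}}" "distinct [v, a, b, c]" "{a, b, c} \<subseteq> pverts G" "a \<in> ?N" "b \<notin> ?N" "c \<notin> ?N" for a b c
    proof -
      have "digraph_iso (with_proj G) (with_proj (graph_T2 m))"
        unfolding extremal_graphs_star_ext
        by (intro iso[where ws = "[v, a, b, c]" and T = "{a}"] core_lists)
          (use that card \<open>m > 2\<close> nv v in \<open>simp_all add: insert_commute\<close>)
      then show ?thesis by blast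
    qed
    have G04: ?iso
      if "?R = {{a, b}, {c, b}}" "distinct [v, a, b, c]" "{a, b, c} \<subseteq> pverts G" "a \<in> ?N" "b \<notin> ?N" "c \<in> ?N" for a b c
    proof -
      have "digraph_iso (with_proj G) (with_proj (graph_G04 m))"
        unfolding extremal_graphs_star_ext
        by (intro iso[where ws = "[v, a, b, c]" and T = "{a, c}"] core_lists)
          (use that card \<open>m > 2\<close> nv v in \<open>simp_all add: insert_commute\<close>)
      then show ?thesis by blast
    qed
    have T3: ?iso
      if "?R = {{a, b}, {c, d}}" "distinct [v, a, b, c, d]" "{a, b, c, d} \<subseteq> pverts G" "a \<in> ?N" "b \<notin> ?N" "c \<in> ?N" "d \<notin> ?N" for a b c d
    proof -
      have "digraph_iso (with_proj G) (with_proj (graph_T3 m))"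
        unfolding extremal_graphs_star_ext
        by (intro iso[where ws = "[v, a, b, c, d]" and T = "{a, c}"] core_lists)
          (use that card \<open>m > 2\<close> nv v in \<open>simp_all add: insert_commute\<close>)
      then show ?thesis by blast
    qed
    have T4: ?iso
      if "?R = {{a, b}, {b, c}}" "distinct [v, a, b, c]" "{a, b, c} \<subseteq> pverts G" "a \<in> ?N" "b \<notin> ?N" "c \<notin> ?N" for a b c
    proof -
      have "digraph_iso (with_proj G) (with_proj (graph_T4 m))"
        unfolding extremal_graphs_star_ext
        by (intro iso[where ws = "[v, a, b, c]" and T = "{a}"] core_lists)
          (use that card \<open>m > 2\<close> nv v in \<open>simp_all add: insert_commute\<close>)
      then show ?thesis by blast
    qed
    \<comment> \<open>Normal form of the two far edges: \<open>a\<close> is adjacent to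
      \<open>v\<close>, and either \<open>c\<close> is as well, or the second edge continues from
      \<open>b\<close> away from \<open>v\<close>, which is the pattern of
      \<open>T4\<close>.\<close>
    have two: ?iso
      if R: "?R = {{a, b}, {c, d}}"
        and ab: "{a, b} \<noteq> {c, d}" "a \<noteq> b" "c \<noteq> d" "a \<noteq> v" "b \<noteq> v" "c \<noteq> v" "d \<noteq> v"
        and V: "{a, b, c, d} \<subseteq> pverts G"
        and adj: "a \<in> ?N" "c \<in> ?N \<or> c = b \<and> b \<notin> ?N \<and> d \<notin> ?N" for a b c d
    proof (cases "c \<in> ?N")
      case False
      then show ?thesis using T4[of a b d] that by auto
    next
      case c: True
      \<comment> \<open>A shared end adjacent to \<open>v\<close> gives \<open>B1\<close>,
        \<open>G13\<close> or \<open>T2\<close>, according to how many of the other two ends are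
        adjacent to \<open>v\<close>; a shared end not adjacent to \<open>v\<close> gives
        \<open>G04\<close>. Disjoint edges give \<open>B2\<close>, \<open>Gv3\<close> or
        \<open>T3\<close>.\<close>
      consider "a = c" | "a = d" | "b = c" | "b = d" | "distinct [v, a, b, c, d]" using ab by auto
      then show ?thesis
      proof cases
        case 1
        then show ?thesis
          using B1[of a b d] G13[of a b d] G13[of a d b] T2[of a b d] that c by (auto simp: insert_commute)
      next
        case 2
        then show ?thesis
          using B1[of a b c] G13[of a c b] that c by (auto simp: insert_commute)
      next
        case 3
        then show ?thesis
          using B1[of b a d] G13[of b a d] that c by (auto simp: insert_commute)
      next
        case 4
        then show ?thesis
          using B1[of b a c] G04[of a b c] that c by (auto simp: insert_commute)
      next
        case 5
        then show ?thesis
          using B2[of a b c d] Gv3[of a b c d] Gv3[of c d a b] T3[of a b c d] that c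
          by (auto simp: insert_commute)
      qed
    qed
    have R: "e \<in> ?R" "f \<in> ?R" using 3 by auto
    have meet: "x \<inter> y \<noteq> {}" if "{x, y} = {e, f}" "y \<inter> ?N = {}" for x y
      using far_edges_meet_each_other[OF conn v, of x y] 3 that by simp
    obtain x y where xy: "{x, y} = {e, f}" "x \<inter> ?N \<noteq> {}"
      using far_edges_meet_nbrs[OF conn v] 3 by (metis insertCI insert_commute singletonD insertE insert_not_empty)
    then have Rxy: "x \<in> ?R" "y \<in> ?R" "x \<noteq> y" "?R = {x, y}" using 3 R by (auto simp: doubleton_eq_iff)
    obtain a b where x: "x = {a, b}" "a \<noteq> b" "a \<noteq> v" "b \<noteq> v" "a \<in> pverts G" "b \<in> pverts G" "a \<in> ?N"
      using Rxy(1) xy(2) by (auto elim!: far_edgesE)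
    obtain c d where y: "y = {c, d}" "c \<noteq> d" "c \<noteq> v" "d \<noteq> v" "c \<in> pverts G" "d \<in> pverts G"
      using Rxy(2) by (auto elim!: far_edgesE)
    consider "c \<in> ?N" | "d \<in> ?N" | "c \<notin> ?N" "d \<notin> ?N" by blast
    then show ?thesis
    proof cases
      case 1
      then show ?thesis using two[of a b c d] x y Rxy by auto
    next
      case 2
      then show ?thesis using two[of a b d c] x y Rxy by (auto simp: insert_commute)
    next
      case 3
      \<comment> \<open>Here \<open>y\<close> has no end adjacent to \<open>v\<close>, so it must
        meet \<open>x\<close>. As \<open>a\<close> is adjacent to \<open>v\<close>, the common
        vertex is \<open>b\<close>.\<close>
      then have "x \<inter> y \<noteq> {}" using meet[of x y] xy y by auto
      then have "b = c \<or> b = d" using x y 3 by auto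
      then show ?thesis using two[of a b c d] two[of a b d c] x y Rxy 3 by (auto simp: insert_commute)
    qed
  qed
qed

end

section \<open>The order of the extremal graphs\<close>

lemma frac_lessI:
  fixes a b c d :: real
  assumes "0 < b" "0 < d" "c * b - a * d > 0"
  shows "a / b < c / d"
  using assms by (simp add: field_simps)

text \<open>The bound 8 is the least value of \<open>m - 1\<close>, below which no relevant root
  lies. The two leading terms form a product with a nonnegative factor, and the rest is
  positive.\<close>

lemma denominators_pos:
  fixes t :: real
  assumes "t \<ge> 8"
  shows "t^3 - 5*t^2 + 6*t - 1 > 0"
    "t^2 - 3*t + 1 > 0"
    "t^2 - 4*t + 2 > 0"
    "t^2 - 4*t + 1 > 0"
    "t^3 - 6*t^2 + 9*t - 3 > 0"
proof -
  have "0 \<le> t^2 * (t - 5)" "0 \<le> t * (t - 3)" "0 \<le> t * (t - 4)" "0 \<le> t^2 * (t - 6)"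
    using assms by simp_all
  moreover have "t^3 - 5*t^2 + 6*t - 1 = t^2 * (t - 5) + (6*t - 1)" "t^2 - 3*t + 1 = t * (t - 3) + 1"
    "t^2 - 4*t + 2 = t * (t - 4) + 2" "t^2 - 4*t + 1 = t * (t - 4) + 1"
    "t^3 - 6*t^2 + 9*t - 3 = t^2 * (t - 6) + (9*t - 3)"
    by (simp_all add: algebra_simps power2_eq_square power3_eq_cube)
  ultimately show "t^3 - 5*t^2 + 6*t - 1 > 0"
    "t^2 - 3*t + 1 > 0"
    "t^2 - 4*t + 2 > 0"
    "t^2 - 4*t + 1 > 0"
    "t^3 - 6*t^2 + 9*t - 3 > 0"
    using assms by linarith+
qed

text \<open>
  Eliminating all vertices but the center from \<open>Q x = t x\<close> turns the center equation of a graph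
  whose center has degree \<open>d\<close> into \<open>t * (t - (d + 1)) = excess t\<close>, where \<open>excess\<close> depends only
  on the core. It is \<open>t - 1\<close> times the sum of the entries at the neighbours of the center, scaled
  to the value 1 at the center, minus \<open>d\<close>, and vanishes for the star.
\<close>

definition excess_T4 :: "real \<Rightarrow> real" where
  "excess_T4 t = t * (t - 2) / (t^3 - 5*t^2 + 6*t - 1)"

definition excess_T3 :: "real \<Rightarrow> real" where
  "excess_T3 t = 2 * t / (t^2 - 3*t + 1)"

definition excess_G04 :: "real \<Rightarrow> real" where
  "excess_G04 t = 2 * t / (t^2 - 4*t + 2)"

definition excess_T2 :: "real \<Rightarrow> real" where
  "excess_T2 t = 2 * t / (t^2 - 4*t + 1)"

definition excess_Gv3 :: "real \<Rightarrow> real" where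
  "excess_Gv3 t = (5*t^2 - 15*t + 4) / ((t - 3) * (t^2 - 3*t + 1))"

definition excess_G13 :: "real \<Rightarrow> real" where
  "excess_G13 t = (5*t^2 - 11*t + 4) / (t^3 - 6*t^2 + 9*t - 3)"

definition excess_B2 :: "real \<Rightarrow> real" where
  "excess_B2 t = 8 / (t - 3)"

definition excess_B1 :: "real \<Rightarrow> real" where
  "excess_B1 t = 8 / (t - 4)"

definition excess_T1 :: "real \<Rightarrow> real" where
  "excess_T1 t = t / (t^2 - 3*t + 1)"

definition excess_G03 :: "real \<Rightarrow> real" where
  "excess_G03 t = 4 / (t - 3)"

lemmas excess_defs = excess_T4_def excess_T3_def excess_G04_def excess_T2_def excess_Gv3_def
  excess_G13_def excess_B2_def excess_B1_def excess_T1_def excess_G03_def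

text \<open>After cross-multiplication and the shift \<open>t = 8 + s\<close>, every difference is a
  polynomial in \<open>s\<close> with positive coefficients only. The first seven comparisons
  concern centers of degree \<open>m - 2\<close>, the last one centers of degree
  \<open>m - 1\<close>.\<close>

lemma excess_order:
  fixes t :: real
  assumes "t \<ge> 8"
  shows "excess_T4 t < excess_T3 t"
    "excess_T3 t < excess_G04 t"
    "excess_G04 t < excess_T2 t"
    "excess_T2 t < excess_Gv3 t"
    "excess_Gv3 t < excess_G13 t"
    "excess_G13 t < excess_B2 t"
    "excess_B2 t < excess_B1 t"
    "excess_T1 t < excess_G03 t"
proof -
  note pos = denominators_pos[OF assms]
  define s where "s = t - 8"
  have s: "s \<ge> 0" and t: "t = 8 + s" using assms by (simp_all add: s_def)
  have "2 * t * (t^3 - 5*t^2 + 6*t - 1) - t * (t - 2) * (t^2 - 3*t + 1)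
      = 1856 + 1168*s + 269*s^2 + 27*s^3 + s^4"
    by (simp add: t algebra_simps power2_eq_square power3_eq_cube power4_eq_xxxx)
  moreover have "1856 + 1168*s + 269*s^2 + 27*s^3 + s^4 > (0::real)" using s by (simp add: add_pos_nonneg)
  ultimately show "excess_T4 t < excess_T3 t"
    using pos assms unfolding excess_defs by (intro frac_lessI) simp_all
  have "2 * t * (t^2 - 3*t + 1) - 2 * t * (t^2 - 4*t + 2)
      = 112 + 30*s + 2*s^2"
    by (simp add: t algebra_simps power2_eq_square power3_eq_cube power4_eq_xxxx)
  moreover have "112 + 30*s + 2*s^2 > (0::real)" using s by (simp add: add_pos_nonneg)
  ultimately show "excess_T3 t < excess_G04 t"
    using pos assms unfolding excess_defs by (intro frac_lessI) simp_all
  have "2 * t * (t^2 - 4*t + 2) - 2 * t * (t^2 - 4*t + 1)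
      = 16 + 2*s"
    by (simp add: t algebra_simps power2_eq_square power3_eq_cube power4_eq_xxxx)
  moreover have "16 + 2*s > (0::real)" using s by (simp add: add_pos_nonneg)
  ultimately show "excess_G04 t < excess_T2 t"
    using pos assms unfolding excess_defs by (intro frac_lessI) simp_all
  have "(5*t^2 - 15*t + 4) * (t^2 - 4*t + 1) - 2 * t * ((t - 3) * (t^2 - 3*t + 1))
      = 3452 + 2487*s + 649*s^2 + 73*s^3 + 3*s^4"
    by (simp add: t algebra_simps power2_eq_square power3_eq_cube power4_eq_xxxx)
  moreover have "3452 + 2487*s + 649*s^2 + 73*s^3 + 3*s^4 > (0::real)" using s by (simp add: add_pos_nonneg)
  ultimately show "excess_T2 t < excess_Gv3 t"
    using pos assms unfolding excess_defs by (intro frac_lessI) simp_all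
  have "(5*t^2 - 11*t + 4) * ((t - 3) * (t^2 - 3*t + 1)) - (5*t^2 - 15*t + 4) * (t^3 - 6*t^2 + 9*t - 3)
      = 8192 + 4936*s + 1105*s^2 + 109*s^3 + 4*s^4"
    by (simp add: t algebra_simps power2_eq_square power3_eq_cube power4_eq_xxxx)
  moreover have "8192 + 4936*s + 1105*s^2 + 109*s^3 + 4*s^4 > (0::real)" using s by (simp add: add_pos_nonneg)
  ultimately show "excess_Gv3 t < excess_G13 t"
    using pos assms unfolding excess_defs by (intro frac_lessI) simp_all
  have "8 * (t^3 - 6*t^2 + 9*t - 3) - (5*t^2 - 11*t + 4) * (t - 3)
      = 396 + 259*s + 50*s^2 + 3*s^3"
    by (simp add: t algebra_simps power2_eq_square power3_eq_cube power4_eq_xxxx)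
  moreover have "396 + 259*s + 50*s^2 + 3*s^3 > (0::real)" using s by (simp add: add_pos_nonneg)
  ultimately show "excess_G13 t < excess_B2 t"
    using pos assms unfolding excess_defs by (intro frac_lessI) simp_all
  have "8 * (t - 3) - 8 * (t - 4)
      = 8"
    by (simp add: t algebra_simps power2_eq_square power3_eq_cube power4_eq_xxxx)
  moreover have "8 > (0::real)" using s by (simp add: add_pos_nonneg)
  ultimately show "excess_B2 t < excess_B1 t"
    using pos assms unfolding excess_defs by (intro frac_lessI) simp_all
  have "4 * (t^2 - 3*t + 1) - t * (t - 3)
      = 124 + 39*s + 3*s^2"
    by (simp add: t algebra_simps power2_eq_square power3_eq_cube power4_eq_xxxx)
  moreover have "124 + 39*s + 3*s^2 > (0::real)" using s by (simp add: add_pos_nonneg)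
  ultimately show "excess_T1 t < excess_G03 t"
    using pos assms unfolding excess_defs by (intro frac_lessI) simp_all
qed

lemma excess_continuous:
  assumes "a \<ge> 8"
  shows "continuous_on {a..b} excess_T4"
    "continuous_on {a..b} excess_T3"
    "continuous_on {a..b} excess_G04"
    "continuous_on {a..b} excess_T2"
    "continuous_on {a..b} excess_Gv3"
    "continuous_on {a..b} excess_G13"
    "continuous_on {a..b} excess_B2"
    "continuous_on {a..b} excess_B1"
    "continuous_on {a..b} excess_T1"
    "continuous_on {a..b} excess_G03"
proof -
  have ge: "t \<ge> 8" if "t \<in> {a..b}" for t using that assms by simp
  have nz: "t^3 - 5*t^2 + 6*t - 1 \<noteq> 0" "t^2 - 3*t + 1 \<noteq> 0" "t^2 - 4*t + 2 \<noteq> 0"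
    "t^2 - 4*t + 1 \<noteq> 0" "t^3 - 6*t^2 + 9*t - 3 \<noteq> 0" "t - 3 \<noteq> 0" "t - 4 \<noteq> 0"
    "(t - 3) * (t^2 - 3*t + 1) \<noteq> 0" if "t \<in> {a..b}" for t
    using denominators_pos[OF ge[OF that]] ge[OF that] by auto
  show "continuous_on {a..b} excess_T4"
    "continuous_on {a..b} excess_T3"
    "continuous_on {a..b} excess_G04"
    "continuous_on {a..b} excess_T2"
    "continuous_on {a..b} excess_Gv3"
    "continuous_on {a..b} excess_G13"
    "continuous_on {a..b} excess_B2"
    "continuous_on {a..b} excess_B1"
    "continuous_on {a..b} excess_T1"
    "continuous_on {a..b} excess_G03"
    unfolding excess_defs[abs_def] by (intro continuous_intros ballI nz; assumption)+
qed

section \<open>Explicit positive eigenvectors\<close>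

lemma q_index_T4:
  assumes "m \<ge> 9" "t \<ge> 8" and eq: "t * (t - (real m - 1)) = excess_T4 t"
  shows "q_index (graph_T4 m) = t"
  unfolding extremal_graphs_star_ext
\<comment> \<open>The entries are solved from the end of the path back to the center, starting from
  1 at the last vertex. The center entry thereby becomes the denominator of the excess.\<close>
proof (rule star_ext_q_index[where x = "nth [t^3 - 5*t^2 + 6*t - 1, t^2 - 3*t + 1, t - 1, 1]"], goal_cases)
  case 1
  show ?case by (rule core_lists)
next
  case 4
  show ?case using \<open>t \<ge> 8\<close> denominators_pos[OF \<open>t \<ge> 8\<close>] by (simp add: upt_rec)
next
  case 5
  show ?case
    by (simp add: upt_rec) (simp add: adj_list_def algebra_simps power2_eq_square power3_eq_cube)
next
  case 6
  have "t^3 - 5*t^2 + 6*t - 1 \<noteq> 0" using denominators_pos[OF \<open>t \<ge> 8\<close>] \<open>t \<ge> 8\<close> by auto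
  then have eq': "t * (t - (real m - 1)) * (t^3 - 5*t^2 + 6*t - 1) = t * (t - 2)"
    using eq by (simp add: excess_T4_def nonzero_eq_divide_eq)
  \<comment> \<open>The number of pendant vertices is a difference of natural numbers;
    \<open>m \<ge> 9\<close> makes it exact.\<close>
  have diff: "real (m - c) = real m - real c" if "c \<le> 9" for c
    using that \<open>m \<ge> 9\<close> by (intro of_nat_diff) simp
  show ?case
    by (simp add: adj_list_def diff)
      (use eq' in \<open>simp add: algebra_simps power2_eq_square power3_eq_cube\<close>)
qed (use assms(1,2) in simp_all)

lemma q_index_T3:
  assumes "m \<ge> 9" "t \<ge> 8" and eq: "t * (t - (real m - 1)) = excess_T3 t"
  shows "q_index (graph_T3 m) = t"
  unfolding extremal_graphs_star_ext
proof (rule star_ext_q_index[where x = "nth [t^2 - 3*t + 1, t - 1, 1, t - 1, 1]"], goal_cases)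
  case 1
  show ?case by (rule core_lists)
next
  case 4
  show ?case using \<open>t \<ge> 8\<close> denominators_pos[OF \<open>t \<ge> 8\<close>] by (simp add: upt_rec)
next
  case 5
  show ?case
    by (simp add: upt_rec) (simp add: adj_list_def algebra_simps power2_eq_square power3_eq_cube)
next
  case 6
  have "t^2 - 3*t + 1 \<noteq> 0" using denominators_pos[OF \<open>t \<ge> 8\<close>] \<open>t \<ge> 8\<close> by auto
  then have eq': "t * (t - (real m - 1)) * (t^2 - 3*t + 1) = 2 * t"
    using eq by (simp add: excess_T3_def nonzero_eq_divide_eq)
  have diff: "real (m - c) = real m - real c" if "c \<le> 9" for c
    using that \<open>m \<ge> 9\<close> by (intro of_nat_diff) simp
  show ?case
    by (simp add: adj_list_def diff)
      (use eq' in \<open>simp add: algebra_simps power2_eq_square power3_eq_cube\<close>)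
qed (use assms(1,2) in simp_all)

lemma q_index_G04:
  assumes "m \<ge> 9" "t \<ge> 8" and eq: "t * (t - (real m - 1)) = excess_G04 t"
  shows "q_index (graph_G04 m) = t"
  unfolding extremal_graphs_star_ext
proof (rule star_ext_q_index[where x = "nth [t^2 - 4*t + 2, t - 2, 2, t - 2]"], goal_cases)
  case 1
  show ?case by (rule core_lists)
next
  case 4
  show ?case using \<open>t \<ge> 8\<close> denominators_pos[OF \<open>t \<ge> 8\<close>] by (simp add: upt_rec)
next
  case 5
  show ?case
    by (simp add: upt_rec) (simp add: adj_list_def algebra_simps power2_eq_square power3_eq_cube)
next
  case 6
  have "t^2 - 4*t + 2 \<noteq> 0" using denominators_pos[OF \<open>t \<ge> 8\<close>] \<open>t \<ge> 8\<close> by auto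
  then have eq': "t * (t - (real m - 1)) * (t^2 - 4*t + 2) = 2 * t"
    using eq by (simp add: excess_G04_def nonzero_eq_divide_eq)
  have diff: "real (m - c) = real m - real c" if "c \<le> 9" for c
    using that \<open>m \<ge> 9\<close> by (intro of_nat_diff) simp
  show ?case
    by (simp add: adj_list_def diff)
      (use eq' in \<open>simp add: algebra_simps power2_eq_square power3_eq_cube\<close>)
qed (use assms(1,2) in simp_all)

lemma q_index_T2:
  assumes "m \<ge> 9" "t \<ge> 8" and eq: "t * (t - (real m - 1)) = excess_T2 t"
  shows "q_index (graph_T2 m) = t"
  unfolding extremal_graphs_star_ext
proof (rule star_ext_q_index[where x = "nth [t^2 - 4*t + 1, t - 1, 1, 1]"], goal_cases)
  case 1
  show ?case by (rule core_lists)
next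
  case 4
  show ?case using \<open>t \<ge> 8\<close> denominators_pos[OF \<open>t \<ge> 8\<close>] by (simp add: upt_rec)
next
  case 5
  show ?case
    by (simp add: upt_rec) (simp add: adj_list_def algebra_simps power2_eq_square power3_eq_cube)
next
  case 6
  have "t^2 - 4*t + 1 \<noteq> 0" using denominators_pos[OF \<open>t \<ge> 8\<close>] \<open>t \<ge> 8\<close> by auto
  then have eq': "t * (t - (real m - 1)) * (t^2 - 4*t + 1) = 2 * t"
    using eq by (simp add: excess_T2_def nonzero_eq_divide_eq)
  have diff: "real (m - c) = real m - real c" if "c \<le> 9" for c
    using that \<open>m \<ge> 9\<close> by (intro of_nat_diff) simp
  show ?case
    by (simp add: adj_list_def diff)
      (use eq' in \<open>simp add: algebra_simps power2_eq_square power3_eq_cube\<close>)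
qed (use assms(1,2) in simp_all)

lemma q_index_Gv3:
  assumes "m \<ge> 9" "t \<ge> 8" and eq: "t * (t - (real m - 1)) = excess_Gv3 t"
  shows "q_index (graph_Gv3 m) = t"
  unfolding extremal_graphs_star_ext
\<comment> \<open>The triangle and the path hang independently at the center; the center entry is
  the product of their two denominators.\<close>
proof (rule star_ext_q_index[where x = "nth [(t - 3) * (t^2 - 3*t + 1), t^2 - 3*t + 1, t^2 - 3*t + 1, (t - 3) * (t - 1), t - 3]"], goal_cases)
  case 1
  show ?case by (rule core_lists)
next
  case 4
  show ?case using \<open>t \<ge> 8\<close> denominators_pos[OF \<open>t \<ge> 8\<close>] by (simp add: upt_rec)
next
  case 5
  show ?case
    by (simp add: upt_rec) (simp add: adj_list_def algebra_simps power2_eq_square power3_eq_cube)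
next
  case 6
  have "(t - 3) * (t^2 - 3*t + 1) \<noteq> 0" using denominators_pos[OF \<open>t \<ge> 8\<close>] \<open>t \<ge> 8\<close> by auto
  then have eq': "t * (t - (real m - 1)) * ((t - 3) * (t^2 - 3*t + 1)) = 5*t^2 - 15*t + 4"
    using eq by (simp add: excess_Gv3_def nonzero_eq_divide_eq)
  have diff: "real (m - c) = real m - real c" if "c \<le> 9" for c
    using that \<open>m \<ge> 9\<close> by (intro of_nat_diff) simp
  show ?case
    by (simp add: adj_list_def diff)
      (use eq' in \<open>simp add: algebra_simps power2_eq_square power3_eq_cube\<close>)
qed (use assms(1,2) in simp_all)

lemma q_index_G13:
  assumes "m \<ge> 9" "t \<ge> 8" and eq: "t * (t - (real m - 1)) = excess_G13 t"
  shows "q_index (graph_G13 m) = t"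
  unfolding extremal_graphs_star_ext
\<comment> \<open>Entry \<open>t - 1\<close> at the leaf 3 forces \<open>(t - 1)^2\<close> at 1.
  Subtracting the equations at 1 and 2 eliminates the center and yields the entry at 2.\<close>
proof (rule star_ext_q_index[where x = "nth [t^3 - 6*t^2 + 9*t - 3, (t - 1)^2, t^2 - 3*t + 1, t - 1]"], goal_cases)
  case 1
  show ?case by (rule core_lists)
next
  case 4
  show ?case using \<open>t \<ge> 8\<close> denominators_pos[OF \<open>t \<ge> 8\<close>] by (simp add: upt_rec)
next
  case 5
  show ?case
    by (simp add: upt_rec) (simp add: adj_list_def algebra_simps power2_eq_square power3_eq_cube)
next
  case 6
  have "t^3 - 6*t^2 + 9*t - 3 \<noteq> 0" using denominators_pos[OF \<open>t \<ge> 8\<close>] \<open>t \<ge> 8\<close> by auto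
  then have eq': "t * (t - (real m - 1)) * (t^3 - 6*t^2 + 9*t - 3) = 5*t^2 - 11*t + 4"
    using eq by (simp add: excess_G13_def nonzero_eq_divide_eq)
  have diff: "real (m - c) = real m - real c" if "c \<le> 9" for c
    using that \<open>m \<ge> 9\<close> by (intro of_nat_diff) simp
  show ?case
    by (simp add: adj_list_def diff)
      (use eq' in \<open>simp add: algebra_simps power2_eq_square power3_eq_cube\<close>)
qed (use assms(1,2) in simp_all)

lemma q_index_B2:
  assumes "m \<ge> 9" "t \<ge> 8" and eq: "t * (t - (real m - 1)) = excess_B2 t"
  shows "q_index (graph_B2 m) = t"
  unfolding extremal_graphs_star_ext
proof (rule star_ext_q_index[where x = "nth [t - 3, 1, 1, 1, 1]"], goal_cases)
  case 1
  show ?case by (rule core_lists)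
next
  case 4
  show ?case using \<open>t \<ge> 8\<close> denominators_pos[OF \<open>t \<ge> 8\<close>] by (simp add: upt_rec)
next
  case 5
  show ?case
    by (simp add: upt_rec) (simp add: adj_list_def algebra_simps power2_eq_square power3_eq_cube)
next
  case 6
  have "t - 3 \<noteq> 0" using denominators_pos[OF \<open>t \<ge> 8\<close>] \<open>t \<ge> 8\<close> by auto
  then have eq': "t * (t - (real m - 1)) * (t - 3) = 8"
    using eq by (simp add: excess_B2_def nonzero_eq_divide_eq)
  have diff: "real (m - c) = real m - real c" if "c \<le> 9" for c
    using that \<open>m \<ge> 9\<close> by (intro of_nat_diff) simp
  show ?case
    by (simp add: adj_list_def diff)
      (use eq' in \<open>simp add: algebra_simps power2_eq_square power3_eq_cube\<close>)
qed (use assms(1,2) in simp_all)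

lemma q_index_B1:
  assumes "m \<ge> 9" "t \<ge> 8" and eq: "t * (t - (real m - 1)) = excess_B1 t"
  shows "q_index (graph_B1 m) = t"
  unfolding extremal_graphs_star_ext
\<comment> \<open>Vertices 2 and 3 get equal entries by symmetry. Subtracting their equation from
  the one at 1 gives the ratio of \<open>t\<close> to \<open>t - 2\<close>.\<close>
proof (rule star_ext_q_index[where x = "nth [(t - 1) * (t - 4), t, t - 2, t - 2]"], goal_cases)
  case 1
  show ?case by (rule core_lists)
next
  case 4
  show ?case using \<open>t \<ge> 8\<close> denominators_pos[OF \<open>t \<ge> 8\<close>] by (simp add: upt_rec)
next
  case 5
  show ?case
    by (simp add: upt_rec) (simp add: adj_list_def algebra_simps power2_eq_square power3_eq_cube)
next
  case 6
  have "t - 4 \<noteq> 0" using denominators_pos[OF \<open>t \<ge> 8\<close>] \<open>t \<ge> 8\<close> by auto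
  then have "t * (t - (real m - 1)) * (t - 4) = 8"
    using eq by (simp add: excess_B1_def nonzero_eq_divide_eq)
  \<comment> \<open>The center entry is \<open>(t - 1) * (t - 4)\<close>, whereas the factor
    \<open>t - 1\<close> is cancelled in \<open>excess_B1\<close>; it is restored here.\<close>
  then have eq': "t * (t - (real m - 1)) * (t - 4) * (t - 1) = 8 * (t - 1)" by simp
  have diff: "real (m - c) = real m - real c" if "c \<le> 9" for c
    using that \<open>m \<ge> 9\<close> by (intro of_nat_diff) simp
  show ?case
    by (simp add: adj_list_def diff)
      (use eq' in \<open>simp add: algebra_simps power2_eq_square power3_eq_cube\<close>)
qed (use assms(1,2) in simp_all)

lemma q_index_T1:
  assumes "m \<ge> 9" "t \<ge> 8" and eq: "t * (t - real m) = excess_T1 t"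
  shows "q_index (graph_T1 m) = t"
  unfolding extremal_graphs_star_ext
proof (rule star_ext_q_index[where x = "nth [t^2 - 3*t + 1, t - 1, 1]"], goal_cases)
  case 1
  show ?case by (rule core_lists)
next
  case 4
  show ?case using \<open>t \<ge> 8\<close> denominators_pos[OF \<open>t \<ge> 8\<close>] by (simp add: upt_rec)
next
  case 5
  show ?case
    by (simp add: upt_rec) (simp add: adj_list_def algebra_simps power2_eq_square power3_eq_cube)
next
  case 6
  have "t^2 - 3*t + 1 \<noteq> 0" using denominators_pos[OF \<open>t \<ge> 8\<close>] \<open>t \<ge> 8\<close> by auto
  then have eq': "t * (t - real m) * (t^2 - 3*t + 1) = t"
    using eq by (simp add: excess_T1_def nonzero_eq_divide_eq)
  have diff: "real (m - c) = real m - real c" if "c \<le> 9" for c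
    using that \<open>m \<ge> 9\<close> by (intro of_nat_diff) simp
  show ?case
    by (simp add: adj_list_def diff)
      (use eq' in \<open>simp add: algebra_simps power2_eq_square power3_eq_cube\<close>)
qed (use assms(1,2) in simp_all)

lemma q_index_G03:
  assumes "m \<ge> 9" "t \<ge> 8" and eq: "t * (t - real m) = excess_G03 t"
  shows "q_index (graph_G03 m) = t"
  unfolding extremal_graphs_star_ext
proof (rule star_ext_q_index[where x = "nth [t - 3, 1, 1]"], goal_cases)
  case 1
  show ?case by (rule core_lists)
next
  case 4
  show ?case using \<open>t \<ge> 8\<close> denominators_pos[OF \<open>t \<ge> 8\<close>] by (simp add: upt_rec)
next
  case 5
  show ?case
    by (simp add: upt_rec) (simp add: adj_list_def algebra_simps power2_eq_square power3_eq_cube)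
next
  case 6
  have "t - 3 \<noteq> 0" using denominators_pos[OF \<open>t \<ge> 8\<close>] \<open>t \<ge> 8\<close> by auto
  then have eq': "t * (t - real m) * (t - 3) = 4"
    using eq by (simp add: excess_G03_def nonzero_eq_divide_eq)
  have diff: "real (m - c) = real m - real c" if "c \<le> 9" for c
    using that \<open>m \<ge> 9\<close> by (intro of_nat_diff) simp
  show ?case
    by (simp add: adj_list_def diff)
      (use eq' in \<open>simp add: algebra_simps power2_eq_square power3_eq_cube\<close>)
qed (use assms(1,2) in simp_all)

lemma q_index_K1:
  assumes "m \<ge> 1"
  shows "q_index (graph_K1 m) = real m + 1"
  unfolding extremal_graphs_star_ext
proof (rule star_ext_q_index[where x = "\<lambda>_. 1"], goal_cases)
  case 1
  show ?case by (rule core_lists)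
qed (use assms in \<open>simp_all add: adj_list_def\<close>)

text \<open>At the old root \<open>y\<close> the difference of the two sides is
  \<open>h y - g y < 0\<close>; at \<open>b\<close>, where \<open>b - c = 1\<close>, it is
  \<open>b - g b > 0\<close>. So the larger excess \<open>g\<close> has a root strictly between. Any
  such root that is at least 8 is the \<open>Q\<close>-index, thanks to its positive
  eigenvector.\<close>

lemma next_root:
  fixes g h :: "real \<Rightarrow> real"
  assumes y: "y < b" "y * (y - c) = h y"
    and less: "h y < g y" "g b < b"
    and cont: "continuous_on {y..b} g" and c: "c = b - 1"
  obtains x where "y < x" "x < b" "x * (x - c) = g x"
proof -
  let ?f = "\<lambda>x. x * (x - c) - g x"
  have "\<exists>x\<ge>y. x \<le> b \<and> ?f x = 0"
  proof (rule IVT')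
    show "continuous_on {y..b} ?f" by (intro continuous_intros cont)
  qed (use y less c in auto)
  then obtain x where "y \<le> x" "x \<le> b" "?f x = 0" by blast
  moreover from this have "x \<noteq> y" "x \<noteq> b" using y less c by auto
  ultimately show thesis using that[of x] by auto
qed

lemma q_index_order:
  assumes m: "m \<ge> 9"
  shows "real m - 1 < q_index (graph_T4 m)" "q_index (graph_T4 m) < q_index (graph_T3 m)"
    "q_index (graph_T3 m) < q_index (graph_G04 m)" "q_index (graph_G04 m) < q_index (graph_T2 m)"
    "q_index (graph_T2 m) < q_index (graph_Gv3 m)" "q_index (graph_Gv3 m) < q_index (graph_G13 m)"
    "q_index (graph_G13 m) < q_index (graph_B2 m)" "q_index (graph_B2 m) < q_index (graph_B1 m)"
    "q_index (graph_B1 m) < q_index (graph_T1 m)" "q_index (graph_T1 m) < q_index (graph_G03 m)"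
    "q_index (graph_G03 m) < q_index (graph_K1 m)"
proof -
  have lower: "real m - 1 \<ge> 8" using m by simp
  \<comment> \<open>The excess of \<open>B1\<close> is the largest among the centers of degree
    \<open>m - 2\<close>, so bounding it at \<open>m\<close> bounds all eight.\<close>
  have "excess_B1 (real m) < real m"
  proof -
    have "9 * 5 \<le> real m * (real m - 4)" by (intro mult_mono) (use m in simp_all)
    then show ?thesis using m by (simp add: excess_B1_def divide_less_eq)
  qed
  with excess_order[of "real m"] m
  have below: "excess_T4 (real m) < real m" "excess_T3 (real m) < real m" "excess_G04 (real m) < real m" "excess_T2 (real m) < real m" "excess_Gv3 (real m) < real m" "excess_G13 (real m) < real m" "excess_B2 (real m) < real m" "excess_B1 (real m) < real m"
    by simp_all
  have pos: "excess_T4 (real m - 1) > 0" "excess_T1 (real m) > 0"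
    using denominators_pos[of "real m - 1"] denominators_pos[of "real m"] m
    by (simp_all add: excess_defs)
  \<comment> \<open>The chain starts at \<open>m - 1\<close>, the root of the equation with excess
    0.\<close>
  obtain t4 where T4: "real m - 1 < t4" "t4 < real m" "t4 * (t4 - (real m - 1)) = excess_T4 t4"
    by (rule next_root[of "real m - 1" "real m" "real m - 1" "\<lambda>_. 0" excess_T4])
      (use below m pos excess_continuous in simp_all)
  obtain x1 where T3: "t4 < x1" "x1 < real m" "x1 * (x1 - (real m - 1)) = excess_T3 x1"
    by (rule next_root[of t4 "real m" "real m - 1" excess_T4 excess_T3,
          OF T4(2,3) excess_order(1) below(2) excess_continuous(2)])
      (use lower T4(1) in linarith)+
  obtain x2 where G04: "x1 < x2" "x2 < real m" "x2 * (x2 - (real m - 1)) = excess_G04 x2"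
    by (rule next_root[of x1 "real m" "real m - 1" excess_T3 excess_G04,
          OF T3(2,3) excess_order(2) below(3) excess_continuous(3)])
      (use lower T4(1) T3(1) in linarith)+
  obtain x3 where T2: "x2 < x3" "x3 < real m" "x3 * (x3 - (real m - 1)) = excess_T2 x3"
    by (rule next_root[of x2 "real m" "real m - 1" excess_G04 excess_T2,
          OF G04(2,3) excess_order(3) below(4) excess_continuous(4)])
      (use lower T4(1) T3(1) G04(1) in linarith)+
  obtain x4 where Gv3: "x3 < x4" "x4 < real m" "x4 * (x4 - (real m - 1)) = excess_Gv3 x4"
    by (rule next_root[of x3 "real m" "real m - 1" excess_T2 excess_Gv3,
          OF T2(2,3) excess_order(4) below(5) excess_continuous(5)])
      (use lower T4(1) T3(1) G04(1) T2(1) in linarith)+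
  obtain x5 where G13: "x4 < x5" "x5 < real m" "x5 * (x5 - (real m - 1)) = excess_G13 x5"
    by (rule next_root[of x4 "real m" "real m - 1" excess_Gv3 excess_G13,
          OF Gv3(2,3) excess_order(5) below(6) excess_continuous(6)])
      (use lower T4(1) T3(1) G04(1) T2(1) Gv3(1) in linarith)+
  obtain x6 where B2: "x5 < x6" "x6 < real m" "x6 * (x6 - (real m - 1)) = excess_B2 x6"
    by (rule next_root[of x5 "real m" "real m - 1" excess_G13 excess_B2,
          OF G13(2,3) excess_order(6) below(7) excess_continuous(7)])
      (use lower T4(1) T3(1) G04(1) T2(1) Gv3(1) G13(1) in linarith)+
  obtain x7 where B1: "x6 < x7" "x7 < real m" "x7 * (x7 - (real m - 1)) = excess_B1 x7"
    by (rule next_root[of x6 "real m" "real m - 1" excess_B2 excess_B1,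
          OF B2(2,3) excess_order(7) below(8) excess_continuous(8)])
      (use lower T4(1) T3(1) G04(1) T2(1) Gv3(1) G13(1) B2(1) in linarith)+
  have "excess_G03 (real m + 1) < real m + 1"
  proof -
    have "9 * 5 \<le> (real m + 1) * (real m - 2)" by (intro mult_mono) (use m in simp_all)
    then show ?thesis using m by (simp add: excess_G03_def divide_less_eq)
  qed
  with excess_order(8)[of "real m + 1"] m
  have below': "excess_T1 (real m + 1) < real m + 1" "excess_G03 (real m + 1) < real m + 1" by simp_all
  \<comment> \<open>A second chain for centers of degree \<open>m - 1\<close>, with roots between
    \<open>m\<close> and \<open>m + 1\<close>.\<close>
  obtain y1 where T1: "real m < y1" "y1 < real m + 1" "y1 * (y1 - real m) = excess_T1 y1"
    by (rule next_root[of "real m" "real m + 1" "real m" "\<lambda>_. 0" excess_T1])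
      (use below' m pos excess_continuous in simp_all)
  obtain y2 where G03: "y1 < y2" "y2 < real m + 1" "y2 * (y2 - real m) = excess_G03 y2"
    by (rule next_root[of y1 "real m + 1" "real m" excess_T1 excess_G03,
          OF T1(2,3) excess_order(8) below'(2) excess_continuous(10)])
      (use lower T1(1) in linarith)+
  have q: "q_index (graph_T4 m) = t4"
    "q_index (graph_T3 m) = x1"
    "q_index (graph_G04 m) = x2"
    "q_index (graph_T2 m) = x3"
    "q_index (graph_Gv3 m) = x4"
    "q_index (graph_G13 m) = x5"
    "q_index (graph_B2 m) = x6"
    "q_index (graph_B1 m) = x7"
    "q_index (graph_T1 m) = y1" "q_index (graph_G03 m) = y2" "q_index (graph_K1 m) = real m + 1"
    using lower m T4(1) T3(1) G04(1) T2(1) Gv3(1) G13(1) B2(1) B1(1) T1(1) G03(1)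
    by (auto intro!: q_index_T4[OF m _ T4(3)] q_index_T3[OF m _ T3(3)] q_index_G04[OF m _ G04(3)]
      q_index_T2[OF m _ T2(3)] q_index_Gv3[OF m _ Gv3(3)] q_index_G13[OF m _ G13(3)]
      q_index_B2[OF m _ B2(3)] q_index_B1[OF m _ B1(3)] q_index_T1[OF m _ T1(3)]
      q_index_G03[OF m _ G03(3)] q_index_K1)
  show "real m - 1 < q_index (graph_T4 m)" using T4(1) q by simp
  show "q_index (graph_T4 m) < q_index (graph_T3 m)" using T3(1) q by simp
  show "q_index (graph_T3 m) < q_index (graph_G04 m)" using G04(1) q by simp
  show "q_index (graph_G04 m) < q_index (graph_T2 m)" using T2(1) q by simp
  show "q_index (graph_T2 m) < q_index (graph_Gv3 m)" using Gv3(1) q by simp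
  show "q_index (graph_Gv3 m) < q_index (graph_G13 m)" using G13(1) q by simp
  show "q_index (graph_G13 m) < q_index (graph_B2 m)" using B2(1) q by simp
  show "q_index (graph_B2 m) < q_index (graph_B1 m)" using B1(1) q by simp
  \<comment> \<open>The two chains are separated by \<open>m\<close>.\<close>
  show "q_index (graph_B1 m) < q_index (graph_T1 m)" using B1(2) T1(1) q by simp
  show "q_index (graph_T1 m) < q_index (graph_G03 m)" using G03(1) q by simp
  show "q_index (graph_G03 m) < q_index (graph_K1 m)" using G03(2) q by simp
qed

theorem theorem1p4:
  fixes m :: nat
  assumes "m \<ge> 9"
  defines "extremal \<equiv>
    [graph_K1 m, graph_G03 m, graph_T1 m, graph_B1 m, graph_B2 m, graph_G13 m, graph_Gv3 m,
     graph_T2 m, graph_G04 m, graph_T3 m, graph_T4 m]"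
  shows "(\<forall>H \<in> set extremal. connected_with_edges m H) \<and>
    q_index (graph_K1 m) > q_index (graph_G03 m) \<and>
    q_index (graph_G03 m) > q_index (graph_T1 m) \<and>
    q_index (graph_T1 m) > q_index (graph_B1 m) \<and>
    q_index (graph_B1 m) > q_index (graph_B2 m) \<and>
    q_index (graph_B2 m) > q_index (graph_G13 m) \<and>
    q_index (graph_G13 m) > q_index (graph_Gv3 m) \<and>
    q_index (graph_Gv3 m) > q_index (graph_T2 m) \<and>
    q_index (graph_T2 m) > q_index (graph_G04 m) \<and>
    q_index (graph_G04 m) > q_index (graph_T3 m) \<and>
    q_index (graph_T3 m) > q_index (graph_T4 m) \<and>
    (\<forall>G :: 'a pair_pre_digraph.
       connected_with_edges m G \<longrightarrow>
       (\<forall>H \<in> set extremal. \<not> digraph_iso (with_proj G) (with_proj H)) \<longrightarrow>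
       q_index G < q_index (graph_T4 m))"
proof (intro conjI ballI allI impI)
  fix H
  assume "H \<in> set extremal"
  then show "connected_with_edges m H"
    using extremal_connected_with_edges[of m] assms by (auto simp: extremal_def)
next
  fix G :: "'a pair_pre_digraph"
  assume G: "connected_with_edges m G"
    and not_iso: "\<forall>H \<in> set extremal. \<not> digraph_iso (with_proj G) (with_proj H)"
  interpret pair_graph G using G by (simp add: connected_with_edges_def)
  have conn: "connected (with_proj G)" and edges: "card (uedges G) = m"
    using G by (simp_all add: connected_with_edges_def)
  \<comment> \<open>A vertex of degree at least \<open>m - 2\<close> would make \<open>G\<close> one
    of the eleven graphs, so the degree bound for \<open>q_index_le_max_degree_small\<close>
    holds.\<close>
  have "card (nbrs v) \<le> m - 3" if "v \<in> pverts G" for v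
  proof (rule ccontr)
    assume "\<not> ?thesis"
    then have "m > 2" "card (nbrs v) \<ge> m - 2" using \<open>m \<ge> 9\<close> by simp_all
    from digraph_iso_extremal[OF conn edges this(1) that this(2)] not_iso
    show False by (simp add: extremal_def)
  qed
  then have "q_index G \<le> real m - 1"
    by (rule q_index_le_max_degree_small[OF conn edges \<open>m \<ge> 9\<close>])
  also have "\<dots> < q_index (graph_T4 m)" by (rule q_index_order(1)[OF \<open>m \<ge> 9\<close>])
  finally show "q_index G < q_index (graph_T4 m)" .
qed (rule q_index_order[OF \<open>m \<ge> 9\<close>])+

end
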